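(* If a group $G$ acts pro-discretely on a chain-connected uniform space $X$, then the induced map $p\colon X\to X/G$ from $X$ to the orbit space $X/G$ is a generalized uniform covering map if its fibers are complete.
   Context: All entourages are symmetric subsets containing the diagonal. The action is a left action by bijections. $X/G$ carries the uniform structure generated by $p$ (base: the sets $p(E)=\{(p(x),p(y)) : (x,y)\in E\}$, $E$ an entourage of $X$). Fibers of $p$ have the subspace uniform structure. For an entourage $F$ of $X$, $S_F=\{h\in G : (x,h\cdot x)\in F\text{ for some }x\in X\}$ and $G_F$ is the subgroup generated by $S_F$. The action is equicontinuous if for every entourage $E$ there is an entourage $F$ with $(g\cdot x,g\cdot y)\in E$ for all $g\in G$ and $(x,y)\in F$. It has small scale bounded orbits if for each entourage $E$ there is an entourage $F$ such that every orbit $A$ of the induced action of $G_F$ on $X$ satisfies $A\times A\subset E$. It is pro-discrete if it is equicontinuous and has small scale bounded orbits. An $E$-chain is a finite sequence $x_1,\dots,x_n$ with $(x_i,x_{i+1})\in E$ for all $i<n$; $X$ is chain-connected if for every entourage $E$ any two points are joined by an $E$-chain. Two chains $c_1,\dots,c_n$ and $d_1,\dots,d_n$ are $E$-close if $(c_i,d_i)\in E$ for all $i\le n$. The Rips complex $R(X,E)$ is the simplicial complex on vertex set $X$ whose simplices are the finite $A\subset X$ with $A\times A\subset E$. A generalized path in $X$ from $x$ to $y$ is a collection $\{[c_E]\}_E$ over all entourages $E$, with $[c_E]$ a homotopy class rel. end-points of paths in $R(X,E)$ from $x$ to $y$, such that for $F\subset E$, $c_F$ is homotopic to $c_E$ rel.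 end-points in $R(X,E)$. A uniformly continuous map induces a map on generalized paths via the induced simplicial maps of Rips complexes. A map $f\colon X\to Y$ between uniform spaces that generates the uniform structure on $Y$ (the sets $f(E)$ are entourages of $Y$ and form a base) is a generalized uniform covering map if it has: 1. chain lifting: $f$ is surjective and for any entourage $E$ of $X$ there is an entourage $F$ of $X$ such that for every $x_0\in X$ any $f(F)$-chain in $Y$ starting from $f(x_0)$ lifts to an $E$-chain starting from $x_0$; 2. approximate uniqueness of chain lifts: for each entourage $E$ of $X$ there is an entourage $F$ of $X$ such that any two $F$-chains in $X$ originating at the same point are $E$-close if their images under $f$ are identical; 3. generalized path lifting: for every $x_0\in X$, any generalized path in $Y$ starting at $f(x_0)$ is the image under $f$ of a generalized path in $X$ starting at $x_0$. *)

theory Defs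
  imports "HOL-Analysis.Analysis" "HOL-Algebra.Group_Action" "HOL-Algebra.Generated_Groups"
begin

section \<open>Uniform structures with symmetric entourages\<close>

text \<open>
  The orbit space is a set of sets rather than a type, so uniform structures are given by a carrier
  \<open>X\<close> and the family \<open>\<U>\<close> of its entourages. All entourages are symmetric; closure under supersets is
  therefore restricted to symmetric supersets.
\<close>

definition uniform_structure :: "'a set \<Rightarrow> ('a \<times> 'a) set set \<Rightarrow> bool" where
  "uniform_structure X \<U> \<longleftrightarrow>
     \<U> \<noteq> {} \<and>
     (\<forall>E\<in>\<U>. E \<subseteq> X \<times> X \<and> Id_on X \<subseteq> E \<and> sym E) \<and>
     (\<forall>E\<in>\<U>. \<forall>F\<in>\<U>. E \<inter> F \<in> \<U>) \<and>
     (\<forall>E\<in>\<U>. \<forall>F. E \<subseteq> F \<longrightarrow> F \<subseteq> X \<times> X \<longrightarrow> sym F \<longrightarrow> F \<in> \<U>) \<and>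
     (\<forall>E\<in>\<U>. \<exists>F\<in>\<U>. F O F \<subseteq> E)"

definition entourages :: "('a::uniform_space \<times> 'a) set set" where
  "entourages = {E. sym E \<and> eventually (\<lambda>q. q \<in> E) uniformity}"

lemma uniform_structure_entourages:
  "uniform_structure UNIV (entourages :: ('a::uniform_space \<times> 'a) set set)"
  unfolding uniform_structure_def
proof (intro conjI ballI allI impI)
  show "(entourages :: ('a \<times> 'a) set set) \<noteq> {}"
    by (auto simp: entourages_def sym_def intro!: exI[of _ UNIV])
next
  fix E :: "('a \<times> 'a) set" assume E: "E \<in> entourages"
  show "E \<subseteq> UNIV \<times> UNIV" by simp
  show "Id_on UNIV \<subseteq> E"
    using E uniformity_refl[of "\<lambda>q. q \<in> E"] by (auto simp: entourages_def)
  show "sym E" using E by (simp add: entourages_def)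
  obtain D where D: "eventually D uniformity" "\<And>x y z. D (x, y) \<Longrightarrow> D (y, z) \<Longrightarrow> (x, z) \<in> E"
    using uniformity_transE[of "\<lambda>q. q \<in> E"] E by (auto simp: entourages_def)
  define F where "F = {(x, y). D (x, y) \<and> D (y, x)}"
  have "eventually (\<lambda>q. q \<in> F) uniformity"
    using eventually_conj[OF D(1) uniformity_sym[OF D(1)]]
    by (rule eventually_mono) (auto simp: F_def)
  then have "F \<in> entourages" by (auto simp: entourages_def F_def sym_def)
  moreover have "F O F \<subseteq> E" using D(2) by (auto simp: F_def)
  ultimately show "\<exists>F\<in>entourages. F O F \<subseteq> E" by blast
next
  fix E F :: "('a \<times> 'a) set" assume "E \<in> entourages" "F \<in> entourages"
  then show "E \<inter> F \<in> entourages"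
    by (auto simp: entourages_def sym_Int eventually_conj_iff)
next
  fix E F :: "('a \<times> 'a) set" assume "E \<in> entourages" "E \<subseteq> F" "sym F"
  then show "F \<in> entourages"
    by (auto simp: entourages_def elim: eventually_mono)
qed

text \<open>The uniform structure on \<open>Y\<close> with base the sets \<open>p(E)\<close>, \<open>E\<close> an entourage of \<open>X\<close>.\<close>

definition generated_entourages ::
  "('a \<times> 'a) set set \<Rightarrow> 'b set \<Rightarrow> ('a \<Rightarrow> 'b) \<Rightarrow> ('b \<times> 'b) set set" where
  "generated_entourages \<U> Y p =
     {D. D \<subseteq> Y \<times> Y \<and> sym D \<and> (\<exists>E\<in>\<U>. map_prod p p ` E \<subseteq> D)}"

definition generates_uniform_structure ::
  "('a \<times> 'a) set set \<Rightarrow> ('b \<times> 'b) set set \<Rightarrow> ('a \<Rightarrow> 'b) \<Rightarrow> bool" where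
  "generates_uniform_structure \<U> \<V> f \<longleftrightarrow>
     (\<forall>E\<in>\<U>. map_prod f f ` E \<in> \<V>) \<and> (\<forall>D\<in>\<V>. \<exists>E\<in>\<U>. map_prod f f ` E \<subseteq> D)"


section \<open>Chains\<close>

definition ent_chain :: "'a set \<Rightarrow> ('a \<times> 'a) set \<Rightarrow> 'a list \<Rightarrow> bool" where
  "ent_chain X E c \<longleftrightarrow> c \<noteq> [] \<and> set c \<subseteq> X \<and> successively (\<lambda>x y. (x, y) \<in> E) c"

definition chain_connected :: "'a set \<Rightarrow> ('a \<times> 'a) set set \<Rightarrow> bool" where
  "chain_connected X \<U> \<longleftrightarrow>
     (\<forall>E\<in>\<U>. \<forall>x\<in>X. \<forall>y\<in>X. \<exists>c. ent_chain X E c \<and> hd c = x \<and> last c = y)"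

definition ent_close :: "('a \<times> 'a) set \<Rightarrow> 'a list \<Rightarrow> 'a list \<Rightarrow> bool" where
  "ent_close E c d \<longleftrightarrow> list_all2 (\<lambda>x y. (x, y) \<in> E) c d"


section \<open>Rips complexes and their geometric realizations\<close>

definition rips_complex :: "'a set \<Rightarrow> ('a \<times> 'a) set \<Rightarrow> 'a set set" where
  "rips_complex X E = {A. finite A \<and> A \<noteq> {} \<and> A \<subseteq> X \<and> A \<times> A \<subseteq> E}"

text \<open>
  Points of the realization are given by barycentric coordinates. On the closed simplex spanned by
  a finite vertex set the topology inherited from the product topology on functions is the Euclidean
  one; the realization carries the weak topology with respect to its closed simplices.
\<close>

definition closed_simplex :: "'a set \<Rightarrow> ('a \<Rightarrow> real) set" where
  "closed_simplex A = {t. (\<forall>v. 0 \<le> t v) \<and> (\<forall>v. v \<notin> A \<longrightarrow> t v = 0) \<and> sum t A = 1}"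

definition realization :: "'a set set \<Rightarrow> ('a \<Rightarrow> real) topology" where
  "realization K =
     topology (\<lambda>U. U \<subseteq> \<Union>(closed_simplex ` K) \<and>
       (\<forall>A\<in>K. openin (top_of_set (closed_simplex A)) (closed_simplex A \<inter> U)))"

lemma openin_realization:
  "openin (realization K) U \<longleftrightarrow>
     U \<subseteq> \<Union>(closed_simplex ` K) \<and>
     (\<forall>A\<in>K. openin (top_of_set (closed_simplex A)) (closed_simplex A \<inter> U))"
proof -
  define P where "P U \<longleftrightarrow> U \<subseteq> \<Union>(closed_simplex ` K) \<and>
       (\<forall>A\<in>K. openin (top_of_set (closed_simplex A)) (closed_simplex A \<inter> U))" for U
  have "P (S \<inter> T)" if "P S" "P T" for S T
  proof -
    have "openin (top_of_set (closed_simplex A)) (closed_simplex A \<inter> (S \<inter> T))" if "A \<in> K" for A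
    proof -
      have "openin (top_of_set (closed_simplex A)) ((closed_simplex A \<inter> S) \<inter> (closed_simplex A \<inter> T))"
        using \<open>P S\<close> \<open>P T\<close> \<open>A \<in> K\<close> by (simp only: P_def openin_Int)
      moreover have "(closed_simplex A \<inter> S) \<inter> (closed_simplex A \<inter> T) = closed_simplex A \<inter> (S \<inter> T)"
        by blast
      ultimately show ?thesis by simp
    qed
    then show ?thesis using \<open>P S\<close> by (auto simp: P_def)
  qed
  moreover have "P (\<Union>\<K>)" if "\<forall>U\<in>\<K>. P U" for \<K>
  proof -
    have "openin (top_of_set (closed_simplex A)) (closed_simplex A \<inter> \<Union>\<K>)" if "A \<in> K" for A
    proof -
      have "\<forall>V\<in>(\<inter>) (closed_simplex A) ` \<K>. openin (top_of_set (closed_simplex A)) V"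
        using that \<open>\<forall>U\<in>\<K>. P U\<close> by (simp add: P_def)
      then have "openin (top_of_set (closed_simplex A)) (\<Union>((\<inter>) (closed_simplex A) ` \<K>))"
        by (simp only: openin_Union)
      then show ?thesis by (simp only: Int_Union)
    qed
    moreover have "\<Union>\<K> \<subseteq> \<Union>(closed_simplex ` K)"
      using \<open>\<forall>U\<in>\<K>. P U\<close> by (intro Union_least) (simp add: P_def)
    ultimately show ?thesis by (simp add: P_def)
  qed
  ultimately have "istopology P" by (simp add: istopology_def)
  moreover have "realization K = topology P" by (simp add: realization_def P_def[abs_def])
  ultimately show ?thesis by (simp add: topology_inverse' P_def)
qed

lemma topspace_realization: "topspace (realization K) = \<Union>(closed_simplex ` K)"
proof (rule antisym)
  show "topspace (realization K) \<subseteq> \<Union>(closed_simplex ` K)"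
    using openin_realization[of K "topspace (realization K)"] by simp
  have "closed_simplex A \<inter> \<Union>(closed_simplex ` K) = closed_simplex A" if "A \<in> K" for A
    using that by blast
  then have "openin (realization K) (\<Union>(closed_simplex ` K))"
    by (simp add: openin_realization)
  then show "\<Union>(closed_simplex ` K) \<subseteq> topspace (realization K)"
    by (rule openin_subset)
qed

definition vertex_pt :: "'a \<Rightarrow> 'a \<Rightarrow> real" where
  "vertex_pt x = (\<lambda>v. if v = x then 1 else 0)"

text \<open>The map of realizations induced by a vertex map.\<close>

definition realization_map :: "('a \<Rightarrow> 'b) \<Rightarrow> ('a \<Rightarrow> real) \<Rightarrow> 'b \<Rightarrow> real" where
  "realization_map f t = (\<lambda>w. \<Sum>v | t v \<noteq> 0 \<and> f v = w. t v)"


section \<open>Generalized paths\<close>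

definition path_between :: "'a topology \<Rightarrow> 'a \<Rightarrow> 'a \<Rightarrow> (real \<Rightarrow> 'a) \<Rightarrow> bool" where
  "path_between T a b q \<longleftrightarrow> pathin T q \<and> q 0 = a \<and> q 1 = b"

definition homotopic_rel_ends :: "'a topology \<Rightarrow> (real \<Rightarrow> 'a) \<Rightarrow> (real \<Rightarrow> 'a) \<Rightarrow> bool" where
  "homotopic_rel_ends T q r \<longleftrightarrow>
     homotopic_with (\<lambda>h. h 0 = q 0 \<and> h 1 = q 1) (top_of_set {0..1}) T q r"

definition path_class :: "'a topology \<Rightarrow> (real \<Rightarrow> 'a) \<Rightarrow> (real \<Rightarrow> 'a) set" where
  "path_class T q = {r. homotopic_rel_ends T q r}"

text \<open>
  A generalized path is a family of homotopy classes indexed by entourages; its values at relations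
  that are not entourages are irrelevant.
\<close>

type_synonym 'a path_family = "('a \<times> 'a) set \<Rightarrow> (real \<Rightarrow> 'a \<Rightarrow> real) set"

definition generalized_path ::
  "'a set \<Rightarrow> ('a \<times> 'a) set set \<Rightarrow> 'a \<Rightarrow> 'a \<Rightarrow> 'a path_family \<Rightarrow> bool" where
  "generalized_path X \<U> x y c \<longleftrightarrow>
     x \<in> X \<and> y \<in> X \<and>
     (\<forall>E\<in>\<U>. \<exists>q. path_between (realization (rips_complex X E)) (vertex_pt x) (vertex_pt y) q \<and>
                 c E = path_class (realization (rips_complex X E)) q) \<and>
     (\<forall>E\<in>\<U>. \<forall>F\<in>\<U>. F \<subseteq> E \<longrightarrow>
        (\<forall>q\<in>c F. \<forall>r\<in>c E. homotopic_rel_ends (realization (rips_complex X E)) q r))"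

text \<open>
  At an entourage \<open>F\<close> of \<open>Y\<close>, the image of \<open>c\<close> is the class of the images of the paths in \<open>c E\<close>, for any
  entourage \<open>E\<close> of \<open>X\<close> with \<open>f(E) \<subseteq> F\<close>. If \<open>c\<close> is a generalized path, this does not depend on \<open>E\<close>, so
  the union over all such \<open>E\<close> is a single class.
\<close>

definition image_path ::
  "('a \<times> 'a) set set \<Rightarrow> 'b set \<Rightarrow> ('a \<Rightarrow> 'b) \<Rightarrow> 'a path_family \<Rightarrow> 'b path_family" where
  "image_path \<U> Y f c = (\<lambda>F.
     \<Union>E\<in>{E\<in>\<U>. map_prod f f ` E \<subseteq> F}.
       \<Union>q\<in>c E. path_class (realization (rips_complex Y F)) (realization_map f \<circ> q))"


section \<open>Generalized uniform covering maps\<close>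

definition chain_lifting ::
  "'a set \<Rightarrow> ('a \<times> 'a) set set \<Rightarrow> 'b set \<Rightarrow> ('a \<Rightarrow> 'b) \<Rightarrow> bool" where
  "chain_lifting X \<U> Y f \<longleftrightarrow>
     f ` X = Y \<and>
     (\<forall>E\<in>\<U>. \<exists>F\<in>\<U>. \<forall>x0\<in>X. \<forall>d. ent_chain Y (map_prod f f ` F) d \<and> hd d = f x0 \<longrightarrow>
        (\<exists>c. ent_chain X E c \<and> hd c = x0 \<and> map f c = d))"

definition approx_unique_chain_lifts ::
  "'a set \<Rightarrow> ('a \<times> 'a) set set \<Rightarrow> ('a \<Rightarrow> 'b) \<Rightarrow> bool" where
  "approx_unique_chain_lifts X \<U> f \<longleftrightarrow>
     (\<forall>E\<in>\<U>. \<exists>F\<in>\<U>. \<forall>c d.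
        ent_chain X F c \<and> ent_chain X F d \<and> hd c = hd d \<and> map f c = map f d \<longrightarrow> ent_close E c d)"

definition generalized_path_lifting ::
  "'a set \<Rightarrow> ('a \<times> 'a) set set \<Rightarrow> 'b set \<Rightarrow> ('b \<times> 'b) set set \<Rightarrow> ('a \<Rightarrow> 'b) \<Rightarrow> bool" where
  "generalized_path_lifting X \<U> Y \<V> f \<longleftrightarrow>
     (\<forall>x0\<in>X. \<forall>y d. generalized_path Y \<V> (f x0) y d \<longrightarrow>
        (\<exists>x c. generalized_path X \<U> x0 x c \<and> f x = y \<and> (\<forall>F\<in>\<V>. image_path \<U> Y f c F = d F)))"

definition generalized_uniform_covering ::
  "'a set \<Rightarrow> ('a \<times> 'a) set set \<Rightarrow> 'b set \<Rightarrow> ('b \<times> 'b) set set \<Rightarrow> ('a \<Rightarrow> 'b) \<Rightarrow> bool" where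
  "generalized_uniform_covering X \<U> Y \<V> f \<longleftrightarrow>
     uniform_structure X \<U> \<and> uniform_structure Y \<V> \<and> f ` X \<subseteq> Y \<and>
     generates_uniform_structure \<U> \<V> f \<and>
     chain_lifting X \<U> Y f \<and>
     approx_unique_chain_lifts X \<U> f \<and>
     generalized_path_lifting X \<U> Y \<V> f"


section \<open>Pro-discrete actions\<close>

definition small_elements ::
  "('g, 'm) monoid_scheme \<Rightarrow> ('g \<Rightarrow> 'a \<Rightarrow> 'a) \<Rightarrow> ('a \<times> 'a) set \<Rightarrow> 'g set" where
  "small_elements G \<phi> F = {h \<in> carrier G. \<exists>x. (x, \<phi> h x) \<in> F}"

definition small_subgroup ::
  "('g, 'm) monoid_scheme \<Rightarrow> ('g \<Rightarrow> 'a \<Rightarrow> 'a) \<Rightarrow> ('a \<times> 'a) set \<Rightarrow> ('g, 'm) monoid_scheme" where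
  "small_subgroup G \<phi> F = G\<lparr>carrier := generate G (small_elements G \<phi> F)\<rparr>"

definition equicontinuous_action ::
  "('g, 'm) monoid_scheme \<Rightarrow> ('g \<Rightarrow> 'a::uniform_space \<Rightarrow> 'a) \<Rightarrow> bool" where
  "equicontinuous_action G \<phi> \<longleftrightarrow>
     (\<forall>E\<in>entourages. \<exists>F\<in>entourages. \<forall>g\<in>carrier G. \<forall>(x, y)\<in>F. (\<phi> g x, \<phi> g y) \<in> E)"

definition small_scale_bounded_orbits ::
  "('g, 'm) monoid_scheme \<Rightarrow> ('g \<Rightarrow> 'a::uniform_space \<Rightarrow> 'a) \<Rightarrow> bool" where
  "small_scale_bounded_orbits G \<phi> \<longleftrightarrow>
     (\<forall>E\<in>entourages. \<exists>F\<in>entourages. \<forall>A\<in>orbits (small_subgroup G \<phi> F) UNIV \<phi>. A \<times> A \<subseteq> E)"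

definition pro_discrete_action ::
  "('g, 'm) monoid_scheme \<Rightarrow> ('g \<Rightarrow> 'a::uniform_space \<Rightarrow> 'a) \<Rightarrow> bool" where
  "pro_discrete_action G \<phi> \<longleftrightarrow> equicontinuous_action G \<phi> \<and> small_scale_bounded_orbits G \<phi>"

end

theory Submission
  imports Defs
begin

text \<open>
  The first two covering properties of the orbit map come from the group. An equicontinuous action
  has a base of invariant entourages, and a step of a chain in the orbit space that starts at the
  orbit of \<open>x\<close> is lifted by translating it to \<open>x\<close>. Two chains \<open>c\<close> and \<open>d\<close> with the same origin and the
  same image satisfy \<open>d k = g k \<cdot> c k\<close> for group elements \<open>g k\<close>; if their steps are small, each
  \<open>g (k + 1) \<cdot> (g k)\<^sup>-\<^sup>1\<close> moves some point by little, so all \<open>g k\<close> lie in the subgroup generated by such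
  elements, and its orbits are small (\<open>pro_discrete_chain_covering\<close>).
  
  The remaining argument concerns an arbitrary map \<open>f\<close> with these two properties. To lift generalized
  paths, paths in Rips complexes are replaced by chains. A path is homotopic to the edge path of a
  chain that approximates it simplicially (\<open>homotopic_approximation\<close>), and a homotopy between paths
  is approximated by a rectangular grid of vertices (\<open>homotopy_grid\<close>). Conversely, a grid in which
  neighbouring vertices are close spans a homotopy by bilinear interpolation (\<open>grid_homotopic\<close>): in a
  Rips complex vertices span a simplex as soon as they are pairwise close.
  
  A grid is lifted row by row. Lifts of neighbouring rows stay close to each other, because the lift
  of a row can be compared, by approximate uniqueness, with a chain chosen near the lift of the
  previous row (\<open>ex_grid_lifting\<close>). Hence chains with homotopic images have lifts with nearby end
  points, and these lifts are homotopic if the end points agree (\<open>ex_homotopy_lifting\<close>).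
  
  Now let a generalized path ending at \<open>y\<close> be given. The end points of the lifts of chains that
  represent it at finer and finer scales generate a Cauchy filter on the fiber over \<open>y\<close>. Let \<open>x\<close> be a
  limit. Moving the last vertex of a fine lift to \<open>x\<close> does not change its image, so at every scale
  there are lifts ending at \<open>x\<close>. Their homotopy classes do not depend on the choices and form the
  required generalized path (\<open>generalized_path_lifting_complete_fibers\<close>).
\<close>

section \<open>Continuity into and out of a realization\<close>

lemma closed_closed_simplex:
  shows "closed (closed_simplex A)"
proof -
  have "closed {t :: 'a \<Rightarrow> real. 0 \<le> t v}" "closed {t :: 'a \<Rightarrow> real. t v = 0}" for v
    by (intro closed_Collect_le closed_Collect_eq continuous_intros continuous_on_product_coordinates)+
  moreover have "closed {t :: 'a \<Rightarrow> real. sum t A = 1}"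
    by (intro closed_Collect_eq continuous_intros continuous_on_product_coordinates)
  moreover have "closed_simplex A =
      (\<Inter>v. {t. 0 \<le> t v}) \<inter> (\<Inter>v\<in>- A. {t. t v = 0}) \<inter> {t. sum t A = 1}"
    by (auto simp: closed_simplex_def)
  ultimately show ?thesis by (simp only:) (intro closed_Int closed_INT; blast)
qed

text \<open>
  A union of finitely many closed simplices has the topology of pointwise convergence: the part of it
  outside a weakly open set is a finite union of closed sets.
\<close>

lemma continuous_map_into_realization:
  assumes f: "continuous_on S f" and "finite L" "L \<subseteq> K"
    and im: "f ` S \<subseteq> \<Union>(closed_simplex ` L)"
  shows "continuous_map (top_of_set S) (realization K) f"
proof -
  have "openin (top_of_set S) {x \<in> S. f x \<in> U}" if U: "openin (realization K) U" for U
  proof -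
    define C where "C = (\<Union>A\<in>L. closed_simplex A - U)"
    have "closed (closed_simplex A - U)" if "A \<in> L" for A
    proof -
      have "openin (top_of_set (closed_simplex A)) (closed_simplex A \<inter> U)"
        using U that \<open>L \<subseteq> K\<close> by (auto simp: openin_realization)
      then have "closedin (top_of_set (closed_simplex A)) (closed_simplex A - closed_simplex A \<inter> U)"
        by (simp add: closedin_def Diff_Diff_Int)
      then show ?thesis
        using closedin_closed_trans[OF _ closed_closed_simplex[of A]] by (simp add: Diff_Int)
    qed
    then have "closed C" unfolding C_def using \<open>finite L\<close> by (intro closed_UN) auto
    then have "openin (top_of_set S) (S \<inter> f -` (- C))"
      using f by (intro continuous_openin_preimage_gen) auto
    moreover have "S \<inter> f -` (- C) = {x \<in> S. f x \<in> U}"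
      using im by (auto simp: C_def)
    ultimately show ?thesis by simp
  qed
  moreover have "f \<in> S \<rightarrow> topspace (realization K)"
    using im \<open>L \<subseteq> K\<close> by (auto simp: topspace_realization)
  ultimately show ?thesis by (simp add: continuous_map_def)
qed

lemma continuous_map_from_realization:
  assumes f: "\<And>A. A \<in> K \<Longrightarrow> continuous_map (top_of_set (closed_simplex A)) T f"
  shows "continuous_map (realization K) T f"
  unfolding continuous_map_def
proof (intro conjI allI impI)
  show "f \<in> topspace (realization K) \<rightarrow> topspace T"
    using f by (fastforce simp: topspace_realization continuous_map_def)
  fix U assume U: "openin T U"
  have "openin (top_of_set (closed_simplex A))
      (closed_simplex A \<inter> {x \<in> topspace (realization K). f x \<in> U})" if "A \<in> K" for A
  proof -
    have "openin (top_of_set (closed_simplex A)) {x \<in> closed_simplex A. f x \<in> U}"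
      using f[OF that] U by (simp add: continuous_map_def)
    moreover have "{x \<in> closed_simplex A. f x \<in> U} =
        closed_simplex A \<inter> {x \<in> topspace (realization K). f x \<in> U}"
      using that by (auto simp: topspace_realization)
    ultimately show ?thesis by simp
  qed
  then show "openin (realization K) {x \<in> topspace (realization K). f x \<in> U}"
    by (auto simp: openin_realization topspace_realization)
qed

lemma continuous_map_realization_euclidean:
  "continuous_map (realization K) euclidean (\<lambda>t. t)"
  by (intro continuous_map_from_realization) (simp add: continuous_on_id)

lemma continuous_map_realization_mono:
  assumes "K \<subseteq> L" "continuous_map S (realization K) q"
  shows "continuous_map S (realization L) q"
proof -
  have "continuous_map (top_of_set (closed_simplex A)) (realization L) (\<lambda>t. t)" if "A \<in> K" for A
    using that \<open>K \<subseteq> L\<close> by (intro continuous_map_into_realization[where L="{A}"]) auto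
  then have "continuous_map (realization K) (realization L) (\<lambda>t. t)"
    by (rule continuous_map_from_realization)
  from continuous_map_compose[OF assms(2) this] show ?thesis by (simp add: o_def)
qed

lemma closed_finite_functions:
  fixes P :: "('a \<Rightarrow> real) set"
  assumes "finite P"
  shows "closed P"
proof -
  have "closed {t}" for t :: "'a \<Rightarrow> real"
  proof -
    have "closed {u :: 'a \<Rightarrow> real. u v = t v}" for v
      by (intro closed_Collect_eq continuous_intros continuous_on_product_coordinates)
    moreover have "{t} = (\<Inter>v. {u. u v = t v})" by auto
    ultimately show ?thesis by (simp only:) (intro closed_INT; blast)
  qed
  then have "closed (\<Union>t\<in>P. {t})" using assms by (intro closed_UN) auto
  then show ?thesis by simp
qed

lemma openin_open_star: "openin (realization K) {t \<in> topspace (realization K). 0 < t v}"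
proof -
  have "open {t :: 'a \<Rightarrow> real. 0 < t v}"
    by (intro open_Collect_less continuous_intros continuous_on_product_coordinates)
  then have "openin euclidean {t :: 'a \<Rightarrow> real. 0 < t v}" by simp
  from openin_continuous_map_preimage[OF continuous_map_realization_euclidean this]
  show ?thesis by simp
qed

lemma simplex_point_support:
  assumes t: "t \<in> closed_simplex A" and "finite A"
  shows "{v. t v \<noteq> 0} \<subseteq> A" "{v. t v \<noteq> 0} \<noteq> {}" "t \<in> closed_simplex {v. t v \<noteq> 0}"
proof -
  show sub: "{v. t v \<noteq> 0} \<subseteq> A" using t by (auto simp: closed_simplex_def)
  have "sum t {v. t v \<noteq> 0} = sum t A"
    using sub \<open>finite A\<close> by (intro sum.mono_neutral_left) auto
  then show "t \<in> closed_simplex {v. t v \<noteq> 0}" using t by (auto simp: closed_simplex_def)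
  then have "sum t {v. t v \<noteq> 0} = 1" by (simp only: closed_simplex_def mem_Collect_eq)
  then show "{v. t v \<noteq> 0} \<noteq> {}" by (metis sum.empty zero_neq_one)
qed

lemma realization_point_support:
  assumes t: "t \<in> topspace (realization (rips_complex X E))"
  shows "{v. t v \<noteq> 0} \<in> rips_complex X E" "t \<in> closed_simplex {v. t v \<noteq> 0}"
proof -
  obtain A where A: "A \<in> rips_complex X E" "t \<in> closed_simplex A"
    using t by (auto simp: topspace_realization)
  then have "finite A" by (simp add: rips_complex_def)
  note supp = simplex_point_support[OF A(2) this]
  show "t \<in> closed_simplex {v. t v \<noteq> 0}" by (rule supp)
  show "{v. t v \<noteq> 0} \<in> rips_complex X E"
    using A(1) supp(1,2) finite_subset[OF supp(1)] by (auto simp: rips_complex_def)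
qed

text \<open>
  Choosing for every vertex \<open>v\<close> that occurs one point of the image with positive \<open>v\<close>-coordinate gives
  a set all of whose subsets meet every closed simplex in a finite set. Such a set is closed and
  discrete, hence finite by compactness.
\<close>

lemma compact_image_finite_support:
  assumes q: "continuous_map (top_of_set S) (realization K) q" and "compact S"
    and fin: "\<And>A. A \<in> K \<Longrightarrow> finite A"
  shows "finite {v. \<exists>s\<in>S. q s v \<noteq> 0}"
proof -
  define W where "W = {v. \<exists>s\<in>S. q s v \<noteq> 0}"
  have "\<forall>v\<in>W. \<exists>t\<in>q ` S. t v \<noteq> 0" by (auto simp: W_def)
  then obtain x where x: "\<And>v. v \<in> W \<Longrightarrow> x v \<in> q ` S" "\<And>v. v \<in> W \<Longrightarrow> x v v \<noteq> 0"
    by metis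
  have top: "q ` S \<subseteq> topspace (realization K)"
    using q by (auto simp: continuous_map_def)
  have fmeet: "finite (closed_simplex A \<inter> x ` W)" if "A \<in> K" for A
  proof (rule finite_subset)
    show "closed_simplex A \<inter> x ` W \<subseteq> x ` A" using x(2) by (auto simp: closed_simplex_def)
    show "finite (x ` A)" using fin[OF that] by simp
  qed
  have cl: "closedin (realization K) P" if P: "P \<subseteq> x ` W" for P
  proof -
    have "openin (top_of_set (closed_simplex A))
        (closed_simplex A \<inter> (topspace (realization K) - P))" if "A \<in> K" for A
    proof -
      have "finite (closed_simplex A \<inter> P)"
        using fmeet[OF that] P by (rule_tac finite_subset) auto
      then have "open (- (closed_simplex A \<inter> P))" by (intro open_Compl closed_finite_functions)
      then have "openin (top_of_set (closed_simplex A)) (closed_simplex A \<inter> - (closed_simplex A \<inter> P))"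
        by (rule openin_open_Int)
      moreover have "closed_simplex A \<inter> - (closed_simplex A \<inter> P) =
          closed_simplex A \<inter> (topspace (realization K) - P)"
        using that by (auto simp: topspace_realization)
      ultimately show ?thesis by simp
    qed
    then have "openin (realization K) (topspace (realization K) - P)"
      by (auto simp: openin_realization topspace_realization)
    then show ?thesis using P x(1) top by (auto simp: closedin_def)
  qed
  have "compactin (realization K) (q ` S)"
    using \<open>compact S\<close> q by (intro image_compactin[where X="top_of_set S"]) (auto simp: compactin_subtopology)
  then have comp: "compactin (realization K) (x ` W)"
    using x(1) by (rule_tac closed_compactin[OF _ _ cl]) auto
  have disc: "subtopology (realization K) (x ` W) = discrete_topology (x ` W)"
  proof -
    have "openin (subtopology (realization K) (x ` W)) P" if "P \<subseteq> x ` W" for P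
    proof -
      have "closedin (subtopology (realization K) (x ` W)) (x ` W - P)"
        using cl[of "x ` W - P"] by (simp add: closedin_subset_topspace)
      moreover have "topspace (realization K) \<inter> x ` W - (x ` W - P) = P"
        using that x(1) top by auto
      ultimately show ?thesis by (simp add: closedin_def)
    qed
    moreover have "topspace (subtopology (realization K) (x ` W)) = x ` W"
      using x(1) top by auto
    ultimately show ?thesis by (subst eq_commute, subst discrete_topology_unique) auto
  qed
  have "finite (x ` W)"
    using comp unfolding compactin_subspace disc by (simp add: compact_space_discrete_topology)
  moreover have "finite {v. t v \<noteq> 0}" if "t \<in> x ` W" for t
  proof -
    have "t \<in> topspace (realization K)" using that x(1) top by auto
    then obtain A where "A \<in> K" "t \<in> closed_simplex A" by (auto simp: topspace_realization)
    then show ?thesis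
      using fin[of A] finite_subset[of "{v. t v \<noteq> 0}" A] by (auto simp: closed_simplex_def)
  qed
  ultimately have "finite (\<Union>t\<in>x ` W. {v. t v \<noteq> 0})" by blast
  moreover have "W \<subseteq> (\<Union>t\<in>x ` W. {v. t v \<noteq> 0})" using x(2) by blast
  ultimately show ?thesis using finite_subset unfolding W_def by blast
qed

section \<open>Points given by weighted families of vertices\<close>

text \<open>
  A vertex may occur at several indices; its barycentric coordinate is then the sum of the weights.
  Chains and grids with repeated vertices are thus treated like those without.
\<close>

definition weighted_point :: "'i set \<Rightarrow> ('i \<Rightarrow> real) \<Rightarrow> ('i \<Rightarrow> 'a) \<Rightarrow> 'a \<Rightarrow> real" where
  "weighted_point I w v = (\<lambda>a. \<Sum>i\<in>I. w i * vertex_pt (v i) a)"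

lemma weighted_point_in_closed_simplex:
  assumes "finite I" "\<And>i. i \<in> I \<Longrightarrow> 0 \<le> w i" "sum w I = 1" "finite A"
    and "\<And>i. i \<in> I \<Longrightarrow> w i \<noteq> 0 \<Longrightarrow> v i \<in> A"
  shows "weighted_point I w v \<in> closed_simplex A"
proof -
  have "(\<Sum>a\<in>A. weighted_point I w v a) = (\<Sum>i\<in>I. \<Sum>a\<in>A. w i * vertex_pt (v i) a)"
    unfolding weighted_point_def by (rule sum.swap)
  also have "\<dots> = (\<Sum>i\<in>I. w i)"
  proof (intro sum.cong refl)
    fix i assume "i \<in> I"
    have "(\<Sum>a\<in>A. w i * vertex_pt (v i) a) = (\<Sum>a\<in>A. if a = v i then w i else 0)"
      by (intro sum.cong) (auto simp: vertex_pt_def)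
    also have "\<dots> = w i"
      using assms(4,5) \<open>i \<in> I\<close> by auto
    finally show "(\<Sum>a\<in>A. w i * vertex_pt (v i) a) = w i" .
  qed
  finally have "(\<Sum>a\<in>A. weighted_point I w v a) = 1" using assms(3) by simp
  moreover have "0 \<le> weighted_point I w v a" for a
    unfolding weighted_point_def using assms(2) by (intro sum_nonneg) (auto simp: vertex_pt_def)
  moreover have "weighted_point I w v a = 0" if "a \<notin> A" for a
    unfolding weighted_point_def using assms(5) that by (intro sum.neutral) (auto simp: vertex_pt_def)
  ultimately show ?thesis by (auto simp: closed_simplex_def)
qed

lemma closed_simplex_singleton: "closed_simplex {x} = {vertex_pt x}"
proof (intro equalityI subsetI)
  fix t assume t: "t \<in> closed_simplex {x}"
  have "t v = vertex_pt x v" for v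
    using t by (cases "v = x") (simp_all add: closed_simplex_def vertex_pt_def)
  then show "t \<in> {vertex_pt x}" by auto
next
  fix t assume "t \<in> {vertex_pt x}"
  then show "t \<in> closed_simplex {x}" by (simp add: closed_simplex_def vertex_pt_def)
qed

lemma weighted_point_const:
  assumes "finite I" "\<And>i. i \<in> I \<Longrightarrow> 0 \<le> w i" "sum w I = 1"
    and "\<And>i. i \<in> I \<Longrightarrow> w i \<noteq> 0 \<Longrightarrow> v i = x"
  shows "weighted_point I w v = vertex_pt x"
  using weighted_point_in_closed_simplex[of I w "{x}" v] assms by (simp add: closed_simplex_singleton)

lemma weighted_point_pos:
  assumes "finite I" "\<And>i. i \<in> I \<Longrightarrow> 0 \<le> w i" "i \<in> I" "0 < w i"
  shows "0 < weighted_point I w v (v i)"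
  unfolding weighted_point_def using assms
  by (intro sum_pos2[where i=i]) (auto simp: vertex_pt_def)

lemma realization_map_weighted_point:
  assumes "finite I"
  shows "realization_map f (weighted_point I w v) = weighted_point I w (f \<circ> v)"
proof
  fix b
  let ?t = "weighted_point I w v"
  have supp: "?t a = 0" if "a \<notin> v ` I" for a
    unfolding weighted_point_def using that by (intro sum.neutral) (auto simp: vertex_pt_def)
  have "realization_map f ?t b = (\<Sum>a\<in>{a \<in> v ` I. f a = b}. ?t a)"
    unfolding realization_map_def
  proof (intro sum.mono_neutral_left)
    show "{a. ?t a \<noteq> 0 \<and> f a = b} \<subseteq> {a \<in> v ` I. f a = b}" using supp by blast
  qed (use assms in auto)
  also have "\<dots> = (\<Sum>i\<in>I. \<Sum>a\<in>{a \<in> v ` I. f a = b}. w i * vertex_pt (v i) a)"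
    unfolding weighted_point_def by (rule sum.swap)
  also have "\<dots> = (\<Sum>i\<in>I. w i * vertex_pt (f (v i)) b)"
  proof (intro sum.cong refl)
    fix i assume "i \<in> I"
    have "(\<Sum>a\<in>{a \<in> v ` I. f a = b}. w i * vertex_pt (v i) a) =
        (\<Sum>a\<in>{a \<in> v ` I. f a = b}. if a = v i then w i else 0)"
      by (intro sum.cong) (auto simp: vertex_pt_def)
    also have "\<dots> = w i * vertex_pt (f (v i)) b"
      using \<open>i \<in> I\<close> assms by (auto simp: vertex_pt_def)
    finally show "(\<Sum>a\<in>{a \<in> v ` I. f a = b}. w i * vertex_pt (v i) a) = w i * vertex_pt (f (v i)) b" .
  qed
  finally show "realization_map f ?t b = weighted_point I w (f \<circ> v) b"
    by (simp add: weighted_point_def)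
qed

text \<open>
  Only pairs of vertices of nonzero weight have to be compared, because a Rips complex is a flag
  complex. The values stay in the finite subcomplex on the vertices \<open>v ` I\<close>, so that pointwise
  continuity suffices.
\<close>

lemma continuous_map_weighted_point:
  assumes "finite I" and cont: "\<And>i. i \<in> I \<Longrightarrow> continuous_on S (\<lambda>s. w s i)"
    and nonneg: "\<And>s i. s \<in> S \<Longrightarrow> i \<in> I \<Longrightarrow> 0 \<le> w s i" and one: "\<And>s. s \<in> S \<Longrightarrow> sum (w s) I = 1"
    and X: "v ` I \<subseteq> X"
    and E: "\<And>s i j. s \<in> S \<Longrightarrow> i \<in> I \<Longrightarrow> j \<in> I \<Longrightarrow> w s i \<noteq> 0 \<Longrightarrow> w s j \<noteq> 0 \<Longrightarrow> (v i, v j) \<in> E"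
  shows "continuous_map (top_of_set S) (realization (rips_complex X E)) (\<lambda>s. weighted_point I (w s) v)"
proof (rule continuous_map_into_realization[where L="rips_complex X E \<inter> Pow (v ` I)"])
  show "continuous_on S (\<lambda>s. weighted_point I (w s) v)"
    unfolding weighted_point_def
    by (intro continuous_on_coordinatewise_then_product continuous_intros cont)
  have "weighted_point I (w s) v \<in> closed_simplex (v ` {i \<in> I. w s i \<noteq> 0})" if "s \<in> S" for s
    using that assms(1) by (intro weighted_point_in_closed_simplex nonneg one) auto
  moreover have "v ` {i \<in> I. w s i \<noteq> 0} \<in> rips_complex X E \<inter> Pow (v ` I)" if s: "s \<in> S" for s
  proof -
    have "{i \<in> I. w s i \<noteq> 0} \<noteq> {}"
    proof
      assume "{i \<in> I. w s i \<noteq> 0} = {}"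
      then have "sum (w s) I = 0" by (intro sum.neutral) auto
      then show False using one[OF s] by simp
    qed
    then show ?thesis using E[OF s] X assms(1) by (auto simp: rips_complex_def)
  qed
  ultimately show "(\<lambda>s. weighted_point I (w s) v) ` S
      \<subseteq> \<Union>(closed_simplex ` (rips_complex X E \<inter> Pow (v ` I)))" by blast
qed (use assms(1) in auto)

text \<open>
  On a closed simplex the induced map is \<open>weighted_point\<close> with the barycentric coordinates as weights.
\<close>

lemma continuous_map_realization_map:
  assumes f: "f ` X \<subseteq> Y" "map_prod f f ` E \<subseteq> D"
  shows "continuous_map (realization (rips_complex X E)) (realization (rips_complex Y D)) (realization_map f)"
proof (rule continuous_map_from_realization)
  fix A assume A: "A \<in> rips_complex X E"
  then have fA: "finite A" by (simp add: rips_complex_def)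
  have "continuous_map (top_of_set (closed_simplex A)) (realization (rips_complex Y D))
      (\<lambda>t. weighted_point A t f)"
  proof (rule continuous_map_weighted_point)
    show "continuous_on (closed_simplex A) (\<lambda>t. t i)" for i
      by (rule continuous_on_subset[OF continuous_on_product_coordinates]) auto
    show "(f i, f j) \<in> D" if "i \<in> A" "j \<in> A" for i j
    proof -
      have "(i, j) \<in> E" using A that by (auto simp: rips_complex_def)
      then have "map_prod f f (i, j) \<in> D" using f(2) by blast
      then show ?thesis by simp
    qed
    show "f ` A \<subseteq> Y" using A f(1) by (auto simp: rips_complex_def)
  qed (auto simp: fA closed_simplex_def)
  then show "continuous_map (top_of_set (closed_simplex A)) (realization (rips_complex Y D)) (realization_map f)"
  proof (rule continuous_map_eq)
    fix t assume "t \<in> topspace (top_of_set (closed_simplex A))"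
    then have t: "t \<in> closed_simplex A" by simp
    have "weighted_point A t id = t"
    proof
      fix a
      have "weighted_point A t id a = (\<Sum>i\<in>A. if i = a then t a else 0)"
        unfolding weighted_point_def by (intro sum.cong) (auto simp: vertex_pt_def)
      then show "weighted_point A t id a = t a" using fA t by (auto simp: closed_simplex_def)
    qed
    then show "weighted_point A t f = realization_map f t"
      using realization_map_weighted_point[OF fA, of f t id] by simp
  qed
qed

section \<open>Homotopies relative to end points\<close>

lemma prod_topology_unit_square:
  "prod_topology (top_of_set {0..1::real}) (top_of_set {0..1::real}) = top_of_set ({0..1::real} \<times> {0..1::real})"
  by (simp flip: subtopology_Times)

lemma homotopic_rel_endsI:
  assumes "continuous_map (top_of_set ({0..1::real} \<times> {0..1::real})) T h"
    and "\<And>s. s \<in> {0..1} \<Longrightarrow> h (0, s) = q s" "\<And>s. s \<in> {0..1} \<Longrightarrow> h (1, s) = r s"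
    and "\<And>t. t \<in> {0..1} \<Longrightarrow> h (t, 0) = q 0" "\<And>t. t \<in> {0..1} \<Longrightarrow> h (t, 1) = q 1"
  shows "homotopic_rel_ends T q r"
  unfolding homotopic_rel_ends_def
proof (subst homotopic_with)
  show "\<exists>h. continuous_map (prod_topology (top_of_set {0..1::real}) (top_of_set {0..1::real})) T h \<and>
        (\<forall>x\<in>topspace (top_of_set {0..1}). h (0, x) = q x) \<and>
        (\<forall>x\<in>topspace (top_of_set {0..1}). h (1, x) = r x) \<and>
        (\<forall>t\<in>{0..1}. h (t, 0) = q 0 \<and> h (t, 1) = q 1)"
    using assms by (intro exI[of _ h]) (auto simp: prod_topology_unit_square)
qed auto

lemma homotopic_rel_ends_map:
  assumes "homotopic_rel_ends T q r"
  shows "\<exists>h. continuous_map (top_of_set ({0..1::real} \<times> {0..1::real})) T h \<and>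
    (\<forall>s. h (0, s) = q s) \<and> (\<forall>s. h (1, s) = r s) \<and>
    (\<forall>t\<in>{0..1}. h (t, 0) = q 0) \<and> (\<forall>t\<in>{0..1}. h (t, 1) = q 1)"
  using assms unfolding homotopic_rel_ends_def homotopic_with_def prod_topology_unit_square
  by blast

lemma homotopic_rel_ends_imp:
  assumes "homotopic_rel_ends T q r"
  shows "pathin T q" "pathin T r" "r 0 = q 0" "r 1 = q 1"
  using homotopic_with_imp_continuous_maps[OF assms[unfolded homotopic_rel_ends_def]]
    homotopic_with_imp_property[OF assms[unfolded homotopic_rel_ends_def]]
  by (auto simp: pathin_def)

lemma homotopic_rel_ends_refl: "pathin T q \<Longrightarrow> homotopic_rel_ends T q q"
  by (simp add: homotopic_rel_ends_def pathin_def)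

lemma homotopic_rel_ends_sym:
  assumes "homotopic_rel_ends T q r" shows "homotopic_rel_ends T r q"
proof -
  have "homotopic_with (\<lambda>h. h 0 = q 0 \<and> h 1 = q 1) (top_of_set {0..1}) T r q"
    using assms unfolding homotopic_rel_ends_def by (rule homotopic_with_sym[THEN iffD1])
  then show ?thesis by (simp only: homotopic_rel_ends_def homotopic_rel_ends_imp(3,4)[OF assms])
qed

lemma homotopic_rel_ends_trans:
  assumes "homotopic_rel_ends T q r" "homotopic_rel_ends T r u"
  shows "homotopic_rel_ends T q u"
  using assms(1) assms(2)[unfolded homotopic_rel_ends_def homotopic_rel_ends_imp(3,4)[OF assms(1)]]
  unfolding homotopic_rel_ends_def by (rule homotopic_with_trans)

lemma homotopic_rel_ends_compose:
  assumes "homotopic_rel_ends T q r" "continuous_map T T' g"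
  shows "homotopic_rel_ends T' (g \<circ> q) (g \<circ> r)"
proof -
  obtain h where h: "continuous_map (top_of_set ({0..1::real} \<times> {0..1::real})) T h"
    "\<And>s. h (0, s) = q s" "\<And>s. h (1, s) = r s"
    "\<And>t. t \<in> {0..1} \<Longrightarrow> h (t, 0) = q 0" "\<And>t. t \<in> {0..1} \<Longrightarrow> h (t, 1) = q 1"
    using homotopic_rel_ends_map[OF assms(1)] by blast
  show ?thesis
    by (rule homotopic_rel_endsI[OF continuous_map_compose[OF h(1) assms(2)]]) (auto simp: h)
qed

lemma rips_complex_mono: "E \<subseteq> E' \<Longrightarrow> rips_complex X E \<subseteq> rips_complex X E'"
  by (auto simp: rips_complex_def)

lemma homotopic_rel_ends_rips_mono:
  assumes "homotopic_rel_ends (realization (rips_complex X E)) q r" "E \<subseteq> E'"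
  shows "homotopic_rel_ends (realization (rips_complex X E')) q r"
proof -
  have "continuous_map (realization (rips_complex X E)) (realization (rips_complex X E')) (\<lambda>t. t)"
    using continuous_map_realization_mono[OF rips_complex_mono[OF assms(2)] continuous_map_id]
    by (simp add: id_def)
  from homotopic_rel_ends_compose[OF assms(1) this] show ?thesis by (simp add: o_def)
qed

lemma rips_point_adjacent:
  assumes "t \<in> topspace (realization (rips_complex X E))" "0 < t u" "0 < t v"
  shows "(u, v) \<in> E" "u \<in> X"
  using realization_point_support(1)[OF assms(1)] assms(2,3) by (auto simp: rips_complex_def)

section \<open>Edge paths and grids\<close>

text \<open>
  The functions \<open>tent (x - i)\<close> for \<open>i \<le> n\<close> form a partition of unity on the interval from \<open>0\<close> to \<open>n\<close>.
\<close>

definition tent :: "real \<Rightarrow> real" where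
  "tent x = max 0 (1 - \<bar>x\<bar>)"

lemma tent_nonneg: "0 \<le> tent x"
  and tent_pos: "\<bar>x\<bar> < 1 \<Longrightarrow> 0 < tent x"
  and tent_neq_0: "tent x \<noteq> 0 \<longleftrightarrow> \<bar>x\<bar> < 1"
  by (auto simp: tent_def)

lemma continuous_on_tent [continuous_intros]:
  "continuous_on S g \<Longrightarrow> continuous_on S (\<lambda>x. tent (g x))"
  unfolding tent_def by (intro continuous_intros)

lemma sum_tent:
  assumes "0 \<le> x" "x \<le> real n"
  shows "(\<Sum>i\<le>n. tent (x - real i)) = 1"
proof -
  have "(\<Sum>i\<le>n. tent (x - real i)) = min 1 (max 0 (real n + 1 - x))" for n
    using assms(1) by (induction n) (auto simp: tent_def)
  then show ?thesis using assms by simp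
qed

lemma tent_int: "tent (real i - real j) = (if i = j then 1 else 0)"
  by (auto simp: tent_def)

text \<open>
  The piecewise linear path that is at \<open>c i\<close> at time \<open>i / n\<close>. Interpolation by tents has an evident
  analogue for grids, with products of tents as weights. For \<open>n = 0\<close> the path is constant.
\<close>

definition edge_path :: "nat \<Rightarrow> (nat \<Rightarrow> 'a) \<Rightarrow> real \<Rightarrow> 'a \<Rightarrow> real" where
  "edge_path n c s = weighted_point {..n} (\<lambda>i. tent (real n * s - real i)) c"

lemma sum_tent_scaled:
  assumes "s \<in> {0..1}"
  shows "(\<Sum>i\<le>n. tent (real n * s - real i)) = 1"
  using assms by (intro sum_tent) (auto simp: mult_left_le)

lemma edge_path_0: "edge_path n c 0 = vertex_pt (c 0)"
  unfolding edge_path_def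
  by (rule weighted_point_const) (use sum_tent_scaled[of 0 n] in \<open>auto simp: tent_nonneg tent_neq_0\<close>)

lemma edge_path_1: "edge_path n c 1 = vertex_pt (c n)"
  unfolding edge_path_def
proof (rule weighted_point_const)
  show "c i = c n" if "i \<in> {..n}" "tent (real n * 1 - real i) \<noteq> 0" for i
    using that tent_int[of n i] by (auto split: if_splits)
qed (use sum_tent_scaled[of 1 n] in \<open>auto simp: tent_nonneg\<close>)

lemma realization_map_edge_path: "realization_map f \<circ> edge_path n c = edge_path n (f \<circ> c)"
proof
  fix s
  show "(realization_map f \<circ> edge_path n c) s = edge_path n (f \<circ> c) s"
    unfolding o_apply[of "realization_map f"] edge_path_def
    by (rule realization_map_weighted_point) simp
qed

lemma edge_path_cong: "(\<And>i. i \<le> n \<Longrightarrow> c i = d i) \<Longrightarrow> edge_path n c = edge_path n d"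
  unfolding edge_path_def weighted_point_def by (intro ext sum.cong) auto

text \<open>
  Bilinear interpolation. The vertices of nonzero weight at a given parameter are corners of a single
  square of the grid, and these are pairwise adjacent.
\<close>

lemma grid_homotopic:
  assumes X: "\<And>j i. j \<le> m \<Longrightarrow> i \<le> n \<Longrightarrow> \<phi> j i \<in> X"
    and E: "\<And>j i j' i'. j \<le> m \<Longrightarrow> i \<le> n \<Longrightarrow> j' \<le> m \<Longrightarrow> i' \<le> n \<Longrightarrow>
        j \<le> Suc j' \<Longrightarrow> j' \<le> Suc j \<Longrightarrow> i \<le> Suc i' \<Longrightarrow> i' \<le> Suc i \<Longrightarrow> (\<phi> j i, \<phi> j' i') \<in> E"
    and ends: "\<And>j. j \<le> m \<Longrightarrow> \<phi> j 0 = \<phi> 0 0" "\<And>j. j \<le> m \<Longrightarrow> \<phi> j n = \<phi> 0 n"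
  shows "homotopic_rel_ends (realization (rips_complex X E)) (edge_path n (\<phi> 0)) (edge_path n (\<phi> m))"
proof -
  define w where "w = (\<lambda>(t, s) (j, i). tent (real m * t - real j) * tent (real n * s - real i))"
  define h where "h z = weighted_point ({..m} \<times> {..n}) (w z) (\<lambda>(j, i). \<phi> j i)" for z
  have wnn: "0 \<le> w z p" for z p by (auto simp: w_def tent_nonneg split: prod.splits)
  have wsum: "sum (w (t, s)) ({..m} \<times> {..n}) = 1" if "t \<in> {0..1}" "s \<in> {0..1}" for t s
    using sum_tent_scaled[OF that(1), of m] sum_tent_scaled[OF that(2), of n]
    by (simp add: w_def sum.cartesian_product[symmetric] flip: sum_product)
  have near: "j \<le> Suc j'" if "\<bar>x - real j\<bar> < 1" "\<bar>x - real j'\<bar> < 1" for x j j'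
    using that by linarith
  have cont: "continuous_map (top_of_set ({0..1::real} \<times> {0..1::real})) (realization (rips_complex X E)) h"
    unfolding h_def
  proof (rule continuous_map_weighted_point)
    show "continuous_on ({0..1} \<times> {0..1}) (\<lambda>z. w z p)" for p
      unfolding w_def by (auto simp: split_beta intro!: continuous_intros)
    show "sum (w z) ({..m} \<times> {..n}) = 1" if "z \<in> {0..1} \<times> {0..1}" for z
      using that wsum by auto
    show "((case p of (j, i) \<Rightarrow> \<phi> j i), (case p' of (j, i) \<Rightarrow> \<phi> j i)) \<in> E"
      if "p \<in> {..m} \<times> {..n}" "p' \<in> {..m} \<times> {..n}" "w z p \<noteq> 0" "w z p' \<noteq> 0" for z p p'
    proof -
      obtain t s j i j' i' where eq: "z = (t, s)" "p = (j, i)" "p' = (j', i')"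
        by (metis surj_pair)
      have "\<bar>real m * t - real j\<bar> < 1" "\<bar>real m * t - real j'\<bar> < 1"
          "\<bar>real n * s - real i\<bar> < 1" "\<bar>real n * s - real i'\<bar> < 1"
        using that(3,4) by (auto simp: w_def eq tent_neq_0)
      then have "j \<le> Suc j'" "j' \<le> Suc j" "i \<le> Suc i'" "i' \<le> Suc i"
        using near by blast+
      then show ?thesis using that(1,2) E by (auto simp: eq)
    qed
  qed (use X wnn in auto)
  have row: "weighted_point ({..m} \<times> {..n}) (\<lambda>(j, i). (if j0 = j then 1 else 0) * y i) (\<lambda>(j, i). \<phi> j i)
      = weighted_point {..n} y (\<phi> j0)" if "j0 \<le> m" for j0 y
  proof
    fix a
    have "weighted_point ({..m} \<times> {..n}) (\<lambda>(j, i). (if j0 = j then 1 else 0) * y i) (\<lambda>(j, i). \<phi> j i) a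
        = (\<Sum>j\<le>m. \<Sum>i\<le>n. (if j0 = j then 1 else 0) * y i * vertex_pt (\<phi> j i) a)"
      by (simp add: weighted_point_def sum.cartesian_product split_beta)
    also have "\<dots> = (\<Sum>j\<le>m. if j0 = j then \<Sum>i\<le>n. y i * vertex_pt (\<phi> j i) a else 0)"
      by (intro sum.cong) auto
    finally show "weighted_point ({..m} \<times> {..n}) (\<lambda>(j, i). (if j0 = j then 1 else 0) * y i)
        (\<lambda>(j, i). \<phi> j i) a = weighted_point {..n} y (\<phi> j0) a"
      using that by (simp add: weighted_point_def)
  qed
  show ?thesis
  proof (rule homotopic_rel_endsI[OF cont])
    show "h (0, s) = edge_path n (\<phi> 0) s" for s
      using row[of 0 "\<lambda>i. tent (real n * s - real i)"] tent_int[of 0]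
      by (simp add: h_def w_def edge_path_def)
    show "h (1, s) = edge_path n (\<phi> m) s" for s
      using row[of m "\<lambda>i. tent (real n * s - real i)"] tent_int[of m]
      by (simp add: h_def w_def edge_path_def)
    show "h (t, 0) = edge_path n (\<phi> 0) 0" if "t \<in> {0..1}" for t
      unfolding h_def edge_path_0
    proof (rule weighted_point_const)
      show "(case p of (j, i) \<Rightarrow> \<phi> j i) = \<phi> 0 0" if "p \<in> {..m} \<times> {..n}" "w (t, 0) p \<noteq> 0" for p
      proof -
        have "fst p \<le> m" "snd p = 0" using that by (auto simp: w_def tent_neq_0)
        then show ?thesis using ends(1)[of "fst p"] by (simp add: split_beta)
      qed
    qed (use wnn wsum that in auto)
    show "h (t, 1) = edge_path n (\<phi> 0) 1" if "t \<in> {0..1}" for t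
      unfolding h_def edge_path_1
    proof (rule weighted_point_const)
      show "(case p of (j, i) \<Rightarrow> \<phi> j i) = \<phi> 0 n" if "p \<in> {..m} \<times> {..n}" "w (t, 1) p \<noteq> 0" for p
      proof -
        have "fst p \<le> m" "snd p = n"
          using that tent_int[of n "snd p"] by (auto simp: w_def split: if_splits)
        then show ?thesis using ends(2)[of "fst p"] by (simp add: split_beta)
      qed
    qed (use wnn wsum that in auto)
  qed
qed

lemma pathin_edge_path:
  assumes X: "\<And>i. i \<le> n \<Longrightarrow> c i \<in> X"
    and E: "\<And>i i'. i \<le> n \<Longrightarrow> i' \<le> n \<Longrightarrow> i \<le> Suc i' \<Longrightarrow> i' \<le> Suc i \<Longrightarrow> (c i, c i') \<in> E"
  shows "pathin (realization (rips_complex X E)) (edge_path n c)"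
  using homotopic_rel_ends_imp(1)[OF grid_homotopic[of 0 n "\<lambda>_. c" X E]] assms by blast

section \<open>Simplicial approximation\<close>

text \<open>
  The condition of simplicial approximation: the points at distance less than \<open>1 / n\<close> from \<open>i / n\<close> are
  mapped to the open star of the vertex \<open>c i\<close>.
\<close>

definition approximates :: "nat \<Rightarrow> (nat \<Rightarrow> 'a) \<Rightarrow> (real \<Rightarrow> 'a \<Rightarrow> real) \<Rightarrow> bool" where
  "approximates n c q \<longleftrightarrow>
     (\<forall>s\<in>{0..1}. \<forall>i\<le>n. \<bar>real n * s - real i\<bar> < 1 \<longrightarrow> 0 < q s (c i))"

lemma edge_path_approximates: "approximates n c (edge_path n c)"
  unfolding approximates_def edge_path_def
  by (auto intro!: weighted_point_pos simp: tent_nonneg tent_pos)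

text \<open>
  Repeating every vertex \<open>k\<close> times keeps the approximation, so that approximations over different
  subdivisions can be compared over a common one.
\<close>

lemma approximates_refine:
  assumes "approximates n c q" "0 < k"
  shows "approximates (n * k) (\<lambda>i. c (i div k)) q"
  unfolding approximates_def
proof (intro ballI allI impI)
  fix s i assume s: "s \<in> {0..1}" and i: "i \<le> n * k" and *: "\<bar>real (n * k) * s - real i\<bar> < 1"
  have "real i = real k * real (i div k) + real (i mod k)"
    by (metis mult_div_mod_eq of_nat_add of_nat_mult)
  moreover have "real (i mod k) + 1 \<le> real k"
    using mod_less_divisor[OF \<open>0 < k\<close>, of i] by linarith
  ultimately have "\<bar>real k * (real n * s - real (i div k))\<bar> < real k * 1"
    using * by (simp add: algebra_simps abs_less_iff)
  then have "\<bar>real n * s - real (i div k)\<bar> < 1"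
    using \<open>0 < k\<close> by (simp add: abs_mult)
  moreover have "i div k \<le> n" using i \<open>0 < k\<close> by (metis div_le_mono nonzero_mult_div_cancel_right less_not_refl)
  ultimately show "0 < q s (c (i div k))" using assms(1) s by (auto simp: approximates_def)
qed

text \<open>
  The midpoint of \<open>i / n\<close> and \<open>i' / n\<close>.
\<close>

lemma common_parameter:
  assumes "i \<le> n" "i' \<le> n" "i \<le> Suc i'" "i' \<le> Suc i"
  obtains s :: real where "s \<in> {0..1}" "\<bar>real n * s - real i\<bar> < 1" "\<bar>real n * s - real i'\<bar> < 1"
proof (cases "n = 0")
  case True
  then show ?thesis using that[of 0] assms by simp
next
  case False
  define s where "s = (real i + real i') / (2 * real n)"
  have "real n * s = (real i + real i') / 2" using False by (simp add: s_def)
  moreover have "s \<in> {0..1}" using assms False by (simp add: s_def)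
  ultimately show ?thesis using that[of s] assms by (simp add: abs_less_iff)
qed

lemma approximates_adjacent:
  assumes q: "pathin (realization (rips_complex X E)) q" and c: "approximates n c q"
    and i: "i \<le> n" "i' \<le> n" "i \<le> Suc i'" "i' \<le> Suc i"
  shows "(c i, c i') \<in> E" "c i \<in> X"
proof -
  obtain s :: real where s: "s \<in> {0..1}" "\<bar>real n * s - real i\<bar> < 1" "\<bar>real n * s - real i'\<bar> < 1"
    using common_parameter[OF i] by blast
  have "q s \<in> topspace (realization (rips_complex X E))"
    using q s(1) by (auto simp: pathin_def continuous_map_def)
  moreover have "0 < q s (c i)" "0 < q s (c i')" using c s i by (auto simp: approximates_def)
  ultimately show "(c i, c i') \<in> E" "c i \<in> X" by (blast dest: rips_point_adjacent)+
qed

lemma vertex_pt_pos: "0 < vertex_pt a u \<longleftrightarrow> u = a"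
  by (simp add: vertex_pt_def)

lemma approximates_ends:
  assumes "approximates n c q"
  shows "q 0 = vertex_pt a \<Longrightarrow> c 0 = a" "q 1 = vertex_pt b \<Longrightarrow> c n = b"
proof -
  have "0 < q 0 (c 0)" "0 < q 1 (c n)"
    using assms by (auto simp: approximates_def)
  then show "q 0 = vertex_pt a \<Longrightarrow> c 0 = a" "q 1 = vertex_pt b \<Longrightarrow> c n = b"
    by (auto simp: vertex_pt_pos)
qed

text \<open>
  At every time the point of the edge path lies in the closed simplex spanned by the support of the
  point of \<open>q\<close>, so the two paths are joined by a straight-line homotopy. It is continuous for the weak
  topology because, by compactness, \<open>q\<close> runs in a finite subcomplex.
\<close>

lemma homotopic_approximation:
  assumes q: "pathin (realization (rips_complex X E)) q" "q 0 = vertex_pt a" "q 1 = vertex_pt b"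
    and c: "approximates n c q"
  shows "homotopic_rel_ends (realization (rips_complex X E)) q (edge_path n c)"
proof -
  let ?R = "realization (rips_complex X E)"
  define e where "e = edge_path n c"
  define W where "W = {v. \<exists>s\<in>{0..1}. q s v \<noteq> 0}"
  have qc: "continuous_map (top_of_set {0..1}) ?R q" using q(1) by (simp add: pathin_def)
  have finW: "finite W"
    unfolding W_def by (rule compact_image_finite_support[OF qc]) (auto simp: rips_complex_def)
  have ec: "continuous_map (top_of_set {0..1}) ?R e"
    using pathin_edge_path[of n c X E] approximates_adjacent[OF q(1) c]
    by (auto simp: pathin_def e_def)
  have coord: "continuous_on {0..1} (\<lambda>s. p s v)"
    if "continuous_map (top_of_set {0..1}) ?R p" for p v
  proof -
    have "continuous_map (top_of_set {0..1}) euclidean ((\<lambda>t. t) \<circ> p)"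
      using that continuous_map_realization_euclidean by (rule continuous_map_compose)
    then have "continuous_on {0..1} p" by (simp add: o_def)
    then show ?thesis by (rule continuous_on_product_then_coordinatewise)
  qed
  define h where "h = (\<lambda>(t, s) v. (1 - t) * q s v + t * e s v)"
  have "continuous_on ({0..1} \<times> {0..1}) (\<lambda>z. h z v)" for v
    unfolding h_def split_beta
    by (intro continuous_intros continuous_on_compose2[OF coord[OF qc]] continuous_on_compose2[OF coord[OF ec]]) auto
  then have "continuous_on ({0..1} \<times> {0..1}) h"
    by (rule continuous_on_coordinatewise_then_product)
  moreover have "h ` ({0..1} \<times> {0..1}) \<subseteq> \<Union>(closed_simplex ` (rips_complex X E \<inter> Pow W))"
  proof clarify
    fix t s :: real assume ts: "t \<in> {0..1}" "s \<in> {0..1}"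
    have "q s \<in> topspace ?R" using qc ts by (auto simp: continuous_map_def)
    note supp = realization_point_support[OF this]
    let ?A = "{v. q s v \<noteq> 0}"
    have fin: "finite ?A" using supp(1) by (simp add: rips_complex_def)
    have "e s \<in> closed_simplex ?A"
      unfolding e_def edge_path_def
    proof (rule weighted_point_in_closed_simplex)
      show "c i \<in> ?A" if "i \<in> {..n}" "tent (real n * s - real i) \<noteq> 0" for i
        using that c ts by (force simp: approximates_def tent_neq_0)
    qed (use sum_tent_scaled[OF ts(2)] fin in \<open>auto simp: tent_nonneg\<close>)
    then have "h (t, s) \<in> closed_simplex ?A"
      using supp(2) ts
      by (auto simp: h_def closed_simplex_def sum.distrib sum_distrib_left[symmetric])
    moreover have "?A \<in> rips_complex X E \<inter> Pow W" using supp(1) ts by (auto simp: W_def)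
    ultimately show "h (t, s) \<in> \<Union>(closed_simplex ` (rips_complex X E \<inter> Pow W))" by blast
  qed
  ultimately have cont: "continuous_map (top_of_set ({0..1::real} \<times> {0..1::real})) ?R h"
    using finW by (intro continuous_map_into_realization[where L="rips_complex X E \<inter> Pow W"]) auto
  have ends: "e 0 = q 0" "e 1 = q 1"
    using approximates_ends[OF c] q by (auto simp: e_def edge_path_0 edge_path_1)
  have "homotopic_rel_ends ?R q e"
    by (rule homotopic_rel_endsI[OF cont]) (auto simp: h_def ends algebra_simps)
  then show ?thesis by (simp add: e_def)
qed

text \<open>
  The preimages of the open stars cover the square. If \<open>2 / n\<close> is smaller than a Lebesgue number of
  this cover, each square of side \<open>2 / n\<close> centred at a grid point lies in one of them.
\<close>

lemma square_approximation:
  assumes h: "continuous_map (top_of_set ({0..1::real} \<times> {0..1::real})) (realization (rips_complex X E)) h"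
  obtains N :: nat where "\<And>n. N \<le> n \<Longrightarrow> \<exists>\<phi>. \<forall>i\<le>n. \<forall>j\<le>n. \<forall>t\<in>{0..1}. \<forall>s\<in>{0..1}.
      \<bar>real n * t - real j\<bar> < 1 \<longrightarrow> \<bar>real n * s - real i\<bar> < 1 \<longrightarrow> 0 < h (t, s) (\<phi> j i)"
proof -
  let ?R = "realization (rips_complex X E)" and ?Q = "{0..1::real} \<times> {0..1::real}"
  have "\<exists>U. open U \<and> {z \<in> ?Q. 0 < h z v} = ?Q \<inter> U" for v
  proof -
    have "openin (top_of_set ?Q) {z \<in> topspace (top_of_set ?Q). h z \<in> {t \<in> topspace ?R. 0 < t v}}"
      by (rule openin_continuous_map_preimage[OF h openin_open_star])
    moreover have "{z \<in> topspace (top_of_set ?Q). h z \<in> {t \<in> topspace ?R. 0 < t v}} = {z \<in> ?Q. 0 < h z v}"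
      using h by (auto simp: continuous_map_def)
    ultimately show ?thesis by (auto simp: openin_open)
  qed
  then obtain U where U: "\<And>v. open (U v)" "\<And>v. {z \<in> ?Q. 0 < h z v} = ?Q \<inter> U v" by metis
  have cover: "?Q \<subseteq> \<Union>(range U)"
  proof
    fix z assume z: "z \<in> ?Q"
    then have "h z \<in> topspace ?R" using h by (auto simp: continuous_map_def)
    from realization_point_support[OF this]
    obtain v where "h z v \<noteq> 0" "0 \<le> h z v" by (auto simp: rips_complex_def closed_simplex_def)
    then have "z \<in> {z \<in> ?Q. 0 < h z v}" using z by auto
    then show "z \<in> \<Union>(range U)" unfolding U(2) by blast
  qed
  obtain e where e: "0 < e" "\<And>z. z \<in> ?Q \<Longrightarrow> \<exists>G\<in>range U. ball z e \<subseteq> G"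
    by (rule Heine_Borel_lemma[OF _ cover]) (auto simp: U(1) intro: compact_Times)
  obtain N :: nat where N: "2 / e < real N" using reals_Archimedean2 by blast
  show ?thesis
  proof (rule that[of N])
    fix n assume "N \<le> n"
    then have n: "2 / e < real n" using N by linarith
    then have n0: "0 < real n" using e(1) by (smt (verit) divide_pos_pos)
    have ex: "\<exists>v. ball (real j / real n, real i / real n) e \<subseteq> U v" if "i \<le> n" "j \<le> n" for i j
      using e(2)[of "(real j / real n, real i / real n)"] that n0 by auto
    define \<phi> where "\<phi> j i = (SOME v. ball (real j / real n, real i / real n) e \<subseteq> U v)" for j i
    have \<phi>: "ball (real j / real n, real i / real n) e \<subseteq> U (\<phi> j i)" if "i \<le> n" "j \<le> n" for i j
      unfolding \<phi>_def using ex[OF that] by (rule someI_ex)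
    show "\<exists>\<phi>. \<forall>i\<le>n. \<forall>j\<le>n. \<forall>t\<in>{0..1}. \<forall>s\<in>{0..1}.
      \<bar>real n * t - real j\<bar> < 1 \<longrightarrow> \<bar>real n * s - real i\<bar> < 1 \<longrightarrow> 0 < h (t, s) (\<phi> j i)"
    proof (intro exI[of _ \<phi>] allI impI ballI)
      fix i j and t s :: real
      assume ij: "i \<le> n" "j \<le> n" and ts: "t \<in> {0..1}" "s \<in> {0..1}"
        and near: "\<bar>real n * t - real j\<bar> < 1" "\<bar>real n * s - real i\<bar> < 1"
      have close: "\<bar>real j / real n - t\<bar> < 1 / real n" if "\<bar>real n * t - real j\<bar> < 1" for t j
      proof -
        have "real j / real n - t = - (real n * t - real j) / real n"
          using n0 by (simp add: field_simps)
        then have "\<bar>real j / real n - t\<bar> = \<bar>real n * t - real j\<bar> / real n"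
          using n0 by simp
        then show ?thesis using that n0 by (simp add: divide_strict_right_mono)
      qed
      have "dist (real j / real n, real i / real n) (t, s)
          \<le> \<bar>real j / real n - t\<bar> + \<bar>real i / real n - s\<bar>"
        unfolding dist_prod_def by (simp add: dist_real_def sqrt_sum_squares_le_sum_abs)
      also have "\<dots> < 2 / real n" using close[OF near(1)] close[OF near(2)] by simp
      also have "\<dots> \<le> e" using n n0 e(1) by (simp add: field_simps)
      finally have "(t, s) \<in> U (\<phi> j i)" using \<phi>[OF ij] by (auto simp: mem_ball)
      then have "(t, s) \<in> {z \<in> ?Q. 0 < h z (\<phi> j i)}" unfolding U(2) using ts by auto
      then show "0 < h (t, s) (\<phi> j i)" by simp
    qed
  qed
qed

lemma path_approximation:
  assumes q: "pathin (realization (rips_complex X E)) q"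
  obtains n c where "0 < n" "approximates n c q"
proof -
  have "continuous_map (prod_topology (top_of_set {0..1::real}) (top_of_set {0..1::real}))
      (realization (rips_complex X E)) (q \<circ> snd)"
    using q by (intro continuous_map_compose[OF continuous_map_snd]) (simp add: pathin_def)
  then have "continuous_map (top_of_set ({0..1::real} \<times> {0..1::real})) (realization (rips_complex X E)) (q \<circ> snd)"
    by (simp only: prod_topology_unit_square)
  from square_approximation[OF this] obtain N :: nat where
    N: "\<And>n. N \<le> n \<Longrightarrow> \<exists>\<phi>. \<forall>i\<le>n. \<forall>j\<le>n. \<forall>t\<in>{0..1}. \<forall>s\<in>{0..1}.
      \<bar>real n * t - real j\<bar> < 1 \<longrightarrow> \<bar>real n * s - real i\<bar> < 1 \<longrightarrow> 0 < (q \<circ> snd) (t, s) (\<phi> j i)"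
    by blast
  obtain \<phi> where \<phi>: "\<forall>i\<le>Suc N. \<forall>j\<le>Suc N. \<forall>t\<in>{0..1}. \<forall>s\<in>{0..1}.
      \<bar>real (Suc N) * t - real j\<bar> < 1 \<longrightarrow> \<bar>real (Suc N) * s - real i\<bar> < 1 \<longrightarrow> 0 < (q \<circ> snd) (t, s) (\<phi> j i)"
    using N[of "Suc N"] by auto
  have "approximates (Suc N) (\<phi> 0) q"
    unfolding approximates_def
  proof (intro ballI allI impI)
    fix s :: real and i assume s: "s \<in> {0..1}" and i: "i \<le> Suc N" "\<bar>real (Suc N) * s - real i\<bar> < 1"
    show "0 < q s (\<phi> 0 i)" using \<phi>[rule_format, of i 0 0 s] s i by simp
  qed
  then show ?thesis by (rule that[OF zero_less_Suc])
qed

text \<open>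
  The grid consists of a grid approximating the homotopy together with two outer rows, the refined
  chains \<open>c\<close> and \<open>d\<close>. An outer row is adjacent to the next one because both approximate the same
  boundary path of the homotopy.
\<close>

lemma homotopy_grid:
  assumes hom: "homotopic_rel_ends (realization (rips_complex X E)) q r"
    and c: "approximates n0 c q" and d: "approximates n1 d r" and pos: "0 < n0" "0 < n1"
    and ends: "q 0 = vertex_pt a" "q 1 = vertex_pt b"
  obtains k k' n m \<phi> where "0 < k" "0 < k'" "n = n0 * k" "n = n1 * k'" "0 < m"
    "\<phi> 0 = (\<lambda>i. c (i div k))" "\<phi> m = (\<lambda>i. d (i div k'))"
    "\<And>j. j \<le> m \<Longrightarrow> \<phi> j 0 = a" "\<And>j. j \<le> m \<Longrightarrow> \<phi> j n = b"
    "\<And>j i. j \<le> m \<Longrightarrow> i < n \<Longrightarrow> (\<phi> j i, \<phi> j (Suc i)) \<in> E"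
    "\<And>j i. j < m \<Longrightarrow> i \<le> n \<Longrightarrow> (\<phi> j i, \<phi> (Suc j) i) \<in> E"
proof -
  let ?R = "realization (rips_complex X E)"
  obtain h where h: "continuous_map (top_of_set ({0..1::real} \<times> {0..1::real})) ?R h"
    "\<And>s. h (0, s) = q s" "\<And>s. h (1, s) = r s"
    "\<And>t. t \<in> {0..1} \<Longrightarrow> h (t, 0) = q 0" "\<And>t. t \<in> {0..1} \<Longrightarrow> h (t, 1) = q 1"
    using homotopic_rel_ends_map[OF hom] by blast
  obtain N :: nat where N: "\<And>n. N \<le> n \<Longrightarrow> \<exists>\<phi>. \<forall>i\<le>n. \<forall>j\<le>n. \<forall>t\<in>{0..1}. \<forall>s\<in>{0..1}.
      \<bar>real n * t - real j\<bar> < 1 \<longrightarrow> \<bar>real n * s - real i\<bar> < 1 \<longrightarrow> 0 < h (t, s) (\<phi> j i)"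
    using square_approximation[OF h(1)] by blast
  define k k' n where "k = n1 * Suc N" and "k' = n0 * Suc N" and "n = n0 * n1 * Suc N"
  have kk: "0 < k" "0 < k'" "n = n0 * k" "n = n1 * k'" using pos by (auto simp: k_def k'_def n_def algebra_simps)
  have "Suc N \<le> n" using pos by (simp add: n_def del: mult_Suc_right)
  then have "N \<le> n" by simp
  from N[OF this] obtain \<psi> where "\<forall>i\<le>n. \<forall>j\<le>n. \<forall>t\<in>{0..1}. \<forall>s\<in>{0..1}.
      \<bar>real n * t - real j\<bar> < 1 \<longrightarrow> \<bar>real n * s - real i\<bar> < 1 \<longrightarrow> 0 < h (t, s) (\<psi> j i)"
    by blast
  note \<psi> = this[rule_format]
  define c' d' where "c' = (\<lambda>i. c (i div k))" and "d' = (\<lambda>i. d (i div k'))"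
  have c': "approximates n c' q" and d': "approximates n d' r"
    using approximates_refine[OF c kk(1)] approximates_refine[OF d kk(2)] kk(3,4)
    by (simp_all add: c'_def d'_def)
  define m where "m = Suc (Suc n)"
  define \<phi> where "\<phi> j = (if j = 0 then c' else if j = m then d' else \<psi> (j - 1))" for j
  \<comment> \<open>Row \<open>j\<close> approximates the path at time \<open>t\<close> of the homotopy. Neighbouring rows share such a
    time, and vertices that approximate the same point span a simplex.\<close>
  define pos_at where "pos_at t j \<longleftrightarrow>
      (\<forall>i\<le>n. \<forall>s\<in>{0..1}. \<bar>real n * s - real i\<bar> < 1 \<longrightarrow> 0 < h (t, s) (\<phi> j i))" for t j
  have p0: "pos_at 0 0" and pm: "pos_at 1 m"
    using c' d' by (auto simp: pos_at_def \<phi>_def m_def h approximates_def)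
  have pj: "pos_at t (Suc j)" if "j \<le> n" "t \<in> {0..1}" "\<bar>real n * t - real j\<bar> < 1" for t j
    unfolding pos_at_def
  proof (intro allI impI ballI)
    fix i and s :: real assume "i \<le> n" "s \<in> {0..1}" "\<bar>real n * s - real i\<bar> < 1"
    from \<psi>[OF this(1) that(1,2) this(2) that(3) this(3)]
    show "0 < h (t, s) (\<phi> (Suc j) i)" using that by (simp add: \<phi>_def m_def)
  qed
  have row: "\<exists>t\<in>{0..1}. pos_at t j \<and> pos_at t j'" if j: "j \<le> m" "j' \<le> m" "j \<le> j'" "j' \<le> Suc j" for j j'
  proof -
    have "j = 0 \<and> (j' = 0 \<or> j' = 1) \<or> j' = m \<and> (j = m \<or> j = Suc n)
        \<or> j = Suc (j - 1) \<and> j' = Suc (j' - 1) \<and> j - 1 \<le> n \<and> j' - 1 \<le> n"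
      using j unfolding m_def by arith
    then consider "j = 0" "j' = 0 \<or> j' = 1" | "j' = m" "j = m \<or> j = Suc n"
      | "j = Suc (j - 1)" "j' = Suc (j' - 1)" "j - 1 \<le> n" "j' - 1 \<le> n" by blast
    then show ?thesis
    proof cases
      case 1
      then show ?thesis using p0 pj[of 0 0] by (intro bexI[of _ 0]) auto
    next
      case 2
      then show ?thesis using pm pj[of n 1] by (intro bexI[of _ 1]) auto
    next
      case 3
      then have "j - 1 \<le> Suc (j' - 1)" "j' - 1 \<le> Suc (j - 1)" using j by linarith+
      from common_parameter[OF 3(3,4) this] obtain t :: real where
        "t \<in> {0..1}" "\<bar>real n * t - real (j - 1)\<bar> < 1" "\<bar>real n * t - real (j' - 1)\<bar> < 1" by blast
      then show ?thesis using pj[OF 3(3)] pj[OF 3(4)] 3(1,2) by metis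
    qed
  qed
  have adj: "(\<phi> j i, \<phi> j' i') \<in> E"
    if "j \<le> m" "j' \<le> m" "j \<le> j'" "j' \<le> Suc j" "i \<le> n" "i' \<le> n" "i \<le> i'" "i' \<le> Suc i" for j j' i i'
  proof -
    from row[OF that(1-4)] obtain t where t: "t \<in> {0..1}" "pos_at t j" "pos_at t j'" by blast
    have i: "i \<le> Suc i'" using that(7) by simp
    from common_parameter[OF that(5,6) i that(8)] obtain s :: real where s: "s \<in> {0..1}" "\<bar>real n * s - real i\<bar> < 1" "\<bar>real n * s - real i'\<bar> < 1" by blast
    have "h (t, s) \<in> topspace ?R" using h(1) t(1) s(1) by (auto simp: continuous_map_def)
    moreover have "0 < h (t, s) (\<phi> j i)" "0 < h (t, s) (\<phi> j' i')"
      using t s that(5,6) by (auto simp: pos_at_def)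
    ultimately show ?thesis by (rule rips_point_adjacent)
  qed
  have end0: "\<phi> j 0 = a" and end1: "\<phi> j n = b" if "j \<le> m" for j
  proof -
    have "\<exists>t\<in>{0..1}. pos_at t j \<and> pos_at t j" using that by (intro row) auto
    then obtain t where t: "t \<in> {0..1}" "pos_at t j" by blast
    have "0 < h (t, 0) (\<phi> j 0)" "0 < h (t, 1) (\<phi> j n)"
      using t by (auto simp: pos_at_def)
    then show "\<phi> j 0 = a" "\<phi> j n = b" using t by (auto simp: h ends vertex_pt_pos)
  qed
  show ?thesis
  proof (rule that[OF kk, where \<phi>=\<phi> and m=m])
    show "\<phi> 0 = (\<lambda>i. c (i div k))" "\<phi> m = (\<lambda>i. d (i div k'))"
      by (simp_all add: \<phi>_def c'_def d'_def m_def)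
    show "0 < m" by (simp add: m_def)
    show "(\<phi> j i, \<phi> j (Suc i)) \<in> E" if "j \<le> m" "i < n" for j i
      using adj[of j j i "Suc i"] that by simp
    show "(\<phi> j i, \<phi> (Suc j) i) \<in> E" if "j < m" "i \<le> n" for j i
      using adj[of j "Suc j" i i] that by simp
  qed (fact end0 end1)+
qed

section \<open>Entourages\<close>

lemma entourage_refl: "E \<in> entourages \<Longrightarrow> (x, x) \<in> E"
  using uniformity_refl[of "\<lambda>q. q \<in> E"] by (simp add: entourages_def)

lemma entourage_sym: "E \<in> entourages \<Longrightarrow> (x, y) \<in> E \<Longrightarrow> (y, x) \<in> E"
  by (rule symD[of E]) (simp_all add: entourages_def)

lemma entourage_Int: "E \<in> entourages \<Longrightarrow> F \<in> entourages \<Longrightarrow> E \<inter> F \<in> entourages"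
  by (simp add: entourages_def sym_Int eventually_conj_iff)

lemma entourage_half:
  fixes E :: "('a::uniform_space \<times> 'a) set"
  shows "E \<in> entourages \<Longrightarrow> \<exists>F\<in>entourages. F O F \<subseteq> E"
proof -
  have "\<forall>E\<in>(entourages :: ('a \<times> 'a) set set). \<exists>F\<in>entourages. F O F \<subseteq> E"
    using uniform_structure_entourages unfolding uniform_structure_def by (elim conjE)
  then show "E \<in> entourages \<Longrightarrow> \<exists>F\<in>entourages. F O F \<subseteq> E"
    by (rule bspec)
qed

lemma entourage_halfE:
  assumes "E \<in> entourages"
  obtains F where "F \<in> entourages" "F \<subseteq> E" "\<And>x y z. (x, y) \<in> F \<Longrightarrow> (y, z) \<in> F \<Longrightarrow> (x, z) \<in> E"
proof -
  obtain F where F: "F \<in> entourages" "F O F \<subseteq> E" using entourage_half[OF assms] by blast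
  have trans: "(x, z) \<in> E" if "(x, y) \<in> F" "(y, z) \<in> F" for x y z
    using F(2) relcompI[OF that] by (rule subsetD)
  have "F \<subseteq> E"
    using trans[OF entourage_refl[OF F(1)]] by (intro subrelI)
  then show ?thesis using that F(1) trans by simp
qed

lemma pathin_edge_path_chain:
  assumes E: "E \<in> entourages" and c: "\<And>i. i < n \<Longrightarrow> (c i, c (Suc i)) \<in> E"
  shows "pathin (realization (rips_complex UNIV E)) (edge_path n c)"
proof (rule pathin_edge_path)
  fix i i' assume "i \<le> n" "i' \<le> n" "i \<le> Suc i'" "i' \<le> Suc i"
  then consider "i = i'" | "i' = Suc i" "i < n" | "i = Suc i'" "i' < n" by linarith
  then show "(c i, c i') \<in> E"
  proof cases
    case 1 then show ?thesis by (simp add: entourage_refl[OF E])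
  next
    case 2 then show ?thesis by (simp add: c)
  next
    case 3 then show ?thesis using entourage_sym[OF E c] by simp
  qed
qed simp

lemma refined_chain:
  assumes refl: "\<And>x. (x, x) \<in> E" and c: "\<And>i. i < n \<Longrightarrow> (c i, c (Suc i)) \<in> E"
    and i: "i < n * k"
  shows "(c (i div k), c (Suc i div k)) \<in> E"
proof -
  have "i div k < n" using i by (metis less_mult_imp_div_less)
  then show ?thesis by (simp add: div_Suc c refl)
qed

text \<open>
  Completeness applied to the filter generated by the sets \<open>T E\<close>.
\<close>

lemma cauchy_family_limit:
  fixes T :: "('a \<times> 'a) set \<Rightarrow> 'a::uniform_space set"
  assumes S: "complete S"
    and T: "\<And>E. E \<in> entourages \<Longrightarrow> T E \<noteq> {}" "\<And>E. E \<in> entourages \<Longrightarrow> T E \<subseteq> S"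
    and mono: "\<And>E F. E \<in> entourages \<Longrightarrow> F \<in> entourages \<Longrightarrow> F \<subseteq> E \<Longrightarrow> T F \<subseteq> T E"
    and cauchy: "\<And>E. E \<in> entourages \<Longrightarrow> \<exists>F\<in>entourages. T F \<times> T F \<subseteq> E"
  shows "\<exists>x\<in>S. \<forall>E\<in>entourages. \<exists>F\<in>entourages. \<forall>z\<in>T F. (z, x) \<in> E"
proof -
  define \<F> where "\<F> = (INF E\<in>entourages. principal (T E))"
  have ne: "(entourages :: ('a \<times> 'a) set set) \<noteq> {}"
    using uniform_structure_entourages unfolding uniform_structure_def by blast
  have ev: "eventually P \<F> \<longleftrightarrow> (\<exists>E\<in>entourages. \<forall>z\<in>T E. P z)" for P
  proof -
    have "\<exists>G\<in>entourages. principal (T G) \<le> inf (principal (T E)) (principal (T F))"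
      if "E \<in> entourages" "F \<in> entourages" for E F
      using that mono[of E "E \<inter> F"] mono[of F "E \<inter> F"]
      by (intro bexI[of _ "E \<inter> F"]) (auto intro: entourage_Int)
    then show ?thesis
      unfolding \<F>_def by (subst eventually_INF_base[OF ne]) (auto simp: eventually_principal)
  qed
  have "\<F> \<noteq> bot"
    using T(1) by (auto simp: trivial_limit_def ev)
  moreover have "\<F> \<le> principal S"
    unfolding le_principal ev using T(2) ne by blast
  moreover have "cauchy_filter \<F>"
    unfolding cauchy_filter_def le_filter_def
  proof (intro allI impI)
    fix P :: "'a \<times> 'a \<Rightarrow> bool" assume P: "eventually P uniformity"
    define E where "E = {(x, y). P (x, y) \<and> P (y, x)}"
    have "eventually (\<lambda>q. q \<in> E) uniformity"
      using eventually_conj[OF P uniformity_sym[OF P]]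
      by (rule eventually_mono) (auto simp: E_def)
    then have "E \<in> entourages" by (auto simp: entourages_def E_def sym_def)
    then obtain F where "F \<in> entourages" "T F \<times> T F \<subseteq> E" using cauchy by blast
    then have "eventually (\<lambda>z. z \<in> T F) \<F>" "\<forall>x\<in>T F. \<forall>y\<in>T F. P (x, y)"
      unfolding ev by (auto simp: E_def)
    then show "eventually P (\<F> \<times>\<^sub>F \<F>)"
      unfolding eventually_prod_same by (intro exI[of _ "\<lambda>z. z \<in> T F"]) auto
  qed
  ultimately obtain x where x: "x \<in> S" "\<F> \<le> nhds x"
    using S unfolding complete_uniform by blast
  have "\<exists>F\<in>entourages. \<forall>z\<in>T F. (z, x) \<in> E" if E: "E \<in> entourages" for E
  proof -
    have "eventually (\<lambda>z. (x, z) \<in> E) (nhds x)"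
      using E unfolding eventually_nhds_uniformity entourages_def by (auto elim: eventually_mono)
    then have "eventually (\<lambda>z. (x, z) \<in> E) \<F>" using x(2) by (simp add: le_filter_def)
    then show ?thesis unfolding ev using entourage_sym[OF E] by blast
  qed
  then show ?thesis using x(1) by blast
qed

section \<open>Lifting grids\<close>

text \<open>
  Chain lifting for chains of length two, which gives the general case by induction, and approximate
  uniqueness of chain lifts for chains indexed by an initial segment of the naturals. In the latter
  it is enough to compare the last points, since the property passes to initial segments.
\<close>

locale chain_covering =
  fixes f :: "'a::uniform_space \<Rightarrow> 'b"
  assumes step_lifting: "E \<in> entourages \<Longrightarrow>
      \<exists>F\<in>entourages. \<forall>x y. (f x, y) \<in> map_prod f f ` F \<longrightarrow> (\<exists>x'. (x, x') \<in> E \<and> f x' = y)"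
    and approx_unique: "E \<in> entourages \<Longrightarrow>
      \<exists>F\<in>entourages. \<forall>n c d. (\<forall>i<n. (c i, c (Suc i)) \<in> F \<and> (d i, d (Suc i)) \<in> F) \<longrightarrow>
        c 0 = d 0 \<longrightarrow> (\<forall>i\<le>n. f (c i) = f (d i)) \<longrightarrow> (c n, d n) \<in> E"
begin

lemma lift_chain:
  assumes "\<And>x y. (f x, y) \<in> D \<Longrightarrow> \<exists>x'. (x, x') \<in> E \<and> f x' = y"
    and "f x = c 0" "\<And>i. i < n \<Longrightarrow> (c i, c (Suc i)) \<in> D"
  shows "\<exists>\<psi>. \<psi> 0 = x \<and> (\<forall>i<n. (\<psi> i, \<psi> (Suc i)) \<in> E) \<and> (\<forall>i\<le>n. f (\<psi> i) = c i)"
  using assms(3)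
proof (induction n)
  case 0
  show ?case using assms(2) by (intro exI[of _ "\<lambda>_. x"]) simp
next
  case (Suc n)
  then obtain \<psi> where \<psi>: "\<psi> 0 = x" "\<forall>i<n. (\<psi> i, \<psi> (Suc i)) \<in> E" "\<forall>i\<le>n. f (\<psi> i) = c i"
    by (metis less_SucI)
  have "(f (\<psi> n), c (Suc n)) \<in> D" using \<psi>(3) Suc.prems by simp
  then obtain x' where "(\<psi> n, x') \<in> E" "f x' = c (Suc n)" using assms(1) by blast
  then show ?case using \<psi>
    by (intro exI[of _ "\<psi>(Suc n := x')"]) (auto simp: less_Suc_eq le_Suc_eq)
qed

text \<open>
  A combinatorial form of homotopy lifting relative to end points. The lifted grid has its outer rows
  prescribed but not its right column: this column lies over one point without being constant, and
  it is only required to stay close to its initial point.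
\<close>

definition grid_lifting :: "('a \<times> 'a) set \<Rightarrow> ('a \<times> 'a) set \<Rightarrow> bool" where
  "grid_lifting E F \<longleftrightarrow> (\<forall>n m \<phi> \<psi>0 \<psi>1. 0 < m \<longrightarrow>
      (\<forall>j\<le>m. \<phi> j 0 = \<phi> 0 0 \<and> \<phi> j n = \<phi> 0 n) \<longrightarrow>
      (\<forall>j\<le>m. \<forall>i<n. (\<phi> j i, \<phi> j (Suc i)) \<in> map_prod f f ` F) \<longrightarrow>
      (\<forall>j<m. \<forall>i\<le>n. (\<phi> j i, \<phi> (Suc j) i) \<in> map_prod f f ` F) \<longrightarrow>
      \<psi>0 0 = \<psi>1 0 \<longrightarrow>
      (\<forall>i<n. (\<psi>0 i, \<psi>0 (Suc i)) \<in> F \<and> (\<psi>1 i, \<psi>1 (Suc i)) \<in> F) \<longrightarrow>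
      (\<forall>i\<le>n. f (\<psi>0 i) = \<phi> 0 i \<and> f (\<psi>1 i) = \<phi> m i) \<longrightarrow>
      (\<exists>\<rho>. \<rho> 0 = \<psi>0 \<and> \<rho> m = \<psi>1 \<and>
        (\<forall>j\<le>m. \<rho> j 0 = \<psi>0 0 \<and> (\<psi>0 n, \<rho> j n) \<in> E) \<and>
        (\<forall>j\<le>m. \<forall>i\<le>n. \<forall>j'\<le>m. \<forall>i'\<le>n.
          j \<le> Suc j' \<longrightarrow> j' \<le> Suc j \<longrightarrow> i \<le> Suc i' \<longrightarrow> i' \<le> Suc i \<longrightarrow> (\<rho> j i, \<rho> j' i') \<in> E)))"

text \<open>
  The inner rows are lifted one at a time, without reference to each other, so errors do not accumulate
  from row to row. Two neighbouring rows are compared through the chain \<open>w\<close> obtained by lifting the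
  vertical edges from the upper row: its steps consist of three small ones, and approximate uniqueness
  makes it close to the lower row. The right column lies over a single point, hence it is close to a
  constant chain, again by approximate uniqueness.
\<close>

lemma ex_grid_lifting:
  assumes E: "E \<in> entourages"
  shows "\<exists>F\<in>entourages. F \<subseteq> E \<and> grid_lifting E F"
proof -
  \<comment> \<open>\<open>A\<close> serves for the right column, \<open>B\<close> for neighbouring rows. Three steps in \<open>L\<close> make one in \<open>B\<close>;
    vertical edges of the lift are in \<open>K\<close>, and so are horizontal ones.\<close>
  obtain A where A: "A \<in> entourages" and Auniq: "\<And>n c d.
      (\<And>i. i < n \<Longrightarrow> (c i, c (Suc i)) \<in> A \<and> (d i, d (Suc i)) \<in> A) \<Longrightarrow>
      c 0 = d 0 \<Longrightarrow> (\<And>i. i \<le> n \<Longrightarrow> f (c i) = f (d i)) \<Longrightarrow> (c n, d n) \<in> E"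
    using approx_unique[OF E] by blast
  obtain K where K: "K \<in> entourages" "K \<subseteq> E \<inter> A"
      "\<And>x y z. (x, y) \<in> K \<Longrightarrow> (y, z) \<in> K \<Longrightarrow> (x, z) \<in> E \<inter> A"
    using entourage_halfE[OF entourage_Int[OF E A]] by metis
  obtain K2 where K2: "K2 \<in> entourages" "K2 \<subseteq> K"
      "\<And>x y z. (x, y) \<in> K2 \<Longrightarrow> (y, z) \<in> K2 \<Longrightarrow> (x, z) \<in> K"
    using entourage_halfE[OF K(1)] by metis
  obtain B where B: "B \<in> entourages" and Buniq: "\<And>n c d.
      (\<And>i. i < n \<Longrightarrow> (c i, c (Suc i)) \<in> B \<and> (d i, d (Suc i)) \<in> B) \<Longrightarrow>
      c 0 = d 0 \<Longrightarrow> (\<And>i. i \<le> n \<Longrightarrow> f (c i) = f (d i)) \<Longrightarrow> (c n, d n) \<in> K2"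
    using approx_unique[OF K2(1)] by blast
  obtain M where M: "M \<in> entourages" "M \<subseteq> B \<inter> K2"
      "\<And>x y z. (x, y) \<in> M \<Longrightarrow> (y, z) \<in> M \<Longrightarrow> (x, z) \<in> B \<inter> K2"
    using entourage_halfE[OF entourage_Int[OF B K2(1)]] by metis
  obtain L where L: "L \<in> entourages" "L \<subseteq> M"
      "\<And>x y z. (x, y) \<in> L \<Longrightarrow> (y, z) \<in> L \<Longrightarrow> (x, z) \<in> M"
    using entourage_halfE[OF M(1)] by metis
  obtain F1 where F1: "F1 \<in> entourages"
      "\<And>x y. (f x, y) \<in> map_prod f f ` F1 \<Longrightarrow> \<exists>x'. (x, x') \<in> L \<and> f x' = y"
    using step_lifting[OF L(1)] by blast
  define F where "F = F1 \<inter> L"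
  have F: "F \<in> entourages" "F \<subseteq> L" using F1(1) L(1) by (auto simp: F_def intro: entourage_Int)
  have lift: "\<exists>x'. (x, x') \<in> L \<and> f x' = y" if "(f x, y) \<in> map_prod f f ` F" for x y
    by (rule F1(2)) (use that in \<open>auto simp: F_def\<close>)
  have sub: "L \<subseteq> K2" "L \<subseteq> K" "L \<subseteq> E" "L \<subseteq> B" using L(2) M(2) K2(2) K(2) by blast+
  have "grid_lifting E F"
    unfolding grid_lifting_def
  proof (intro allI impI)
    fix n m \<phi> \<psi>0 \<psi>1
    assume m: "0 < m" and ends: "\<forall>j\<le>m. \<phi> j 0 = \<phi> 0 0 \<and> \<phi> j n = \<phi> 0 n"
      and hor: "\<forall>j\<le>m. \<forall>i<n. (\<phi> j i, \<phi> j (Suc i)) \<in> map_prod f f ` F"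
      and ver: "\<forall>j<m. \<forall>i\<le>n. (\<phi> j i, \<phi> (Suc j) i) \<in> map_prod f f ` F"
      and start: "\<psi>0 0 = \<psi>1 0"
      and chains: "\<forall>i<n. (\<psi>0 i, \<psi>0 (Suc i)) \<in> F \<and> (\<psi>1 i, \<psi>1 (Suc i)) \<in> F"
      and images: "\<forall>i\<le>n. f (\<psi>0 i) = \<phi> 0 i \<and> f (\<psi>1 i) = \<phi> m i"
    define x where "x = \<psi>0 0"
    have left: "\<phi> j 0 = f x" and right: "\<phi> j n = \<phi> 0 n" if "j \<le> m" for j
    proof -
      have "\<phi> j 0 = \<phi> 0 0" using ends that by blast
      moreover have "f x = \<phi> 0 0" using images by (simp add: x_def)
      ultimately show "\<phi> j 0 = f x" by simp
      show "\<phi> j n = \<phi> 0 n" using ends that by blast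
    qed
    have "\<exists>r. r 0 = x \<and> (\<forall>i<n. (r i, r (Suc i)) \<in> L) \<and> (\<forall>i\<le>n. f (r i) = \<phi> j i)" if "j \<le> m" for j
    proof (rule lift_chain[where D="map_prod f f ` F", OF lift])
      show "f x = \<phi> j 0" using left[OF that] by simp
      show "(\<phi> j i, \<phi> j (Suc i)) \<in> map_prod f f ` F" if "i < n" for i
        using hor \<open>j \<le> m\<close> that by blast
    qed
    then obtain \<rho>' where \<rho>': "\<And>j. j \<le> m \<Longrightarrow>
        \<rho>' j 0 = x \<and> (\<forall>i<n. (\<rho>' j i, \<rho>' j (Suc i)) \<in> L) \<and> (\<forall>i\<le>n. f (\<rho>' j i) = \<phi> j i)"
      by metis
    define \<rho> where "\<rho> j = (if j = 0 then \<psi>0 else if j = m then \<psi>1 else \<rho>' j)" for j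
    have \<rho>: "\<rho> j 0 = x" "\<And>i. i < n \<Longrightarrow> (\<rho> j i, \<rho> j (Suc i)) \<in> L" "\<And>i. i \<le> n \<Longrightarrow> f (\<rho> j i) = \<phi> j i"
      if "j \<le> m" for j
      using \<rho>'[OF that] chains images start F(2) that by (auto simp: \<rho>_def x_def)
    have col: "(\<rho> j i, \<rho> (Suc j) i) \<in> K" if j: "j < m" and i: "i \<le> n" for j i
    proof -
      have "\<exists>z. (\<rho> j i, z) \<in> L \<and> f z = \<phi> (Suc j) i" if "i \<le> n" for i
      proof (rule lift)
        show "(f (\<rho> j i), \<phi> (Suc j) i) \<in> map_prod f f ` F"
          using \<rho>(3)[of j i] ver j that by simp
      qed
      then obtain w' where w': "\<And>i. i \<le> n \<Longrightarrow> (\<rho> j i, w' i) \<in> L" "\<And>i. i \<le> n \<Longrightarrow> f (w' i) = \<phi> (Suc j) i"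
        by metis
      define w where "w i = (if i = 0 then x else w' i)" for i
      have w: "(\<rho> j i, w i) \<in> L" "f (w i) = \<phi> (Suc j) i" if "i \<le> n" for i
        using w'[OF that] \<rho>(1)[of j] left[of "Suc j"] j entourage_refl[OF L(1)] by (auto simp: w_def)
      \<comment> \<open>The three steps from \<open>w l\<close> to \<open>w (Suc l)\<close> pass through \<open>\<rho> j l\<close> and \<open>\<rho> j (Suc l)\<close>.\<close>
      have "(w i, \<rho> (Suc j) i) \<in> K2"
      proof (rule Buniq)
        fix l assume "l < i"
        then have l: "l \<le> n" "l < n" "Suc l \<le> n" using i by auto
        have "(w l, \<rho> j l) \<in> L" using w(1)[OF l(1)] entourage_sym[OF L(1)] by blast
        then have "(w l, \<rho> j (Suc l)) \<in> M" using L(3) \<rho>(2)[of j l] l j by auto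
        moreover have "(\<rho> j (Suc l), w (Suc l)) \<in> M" using w(1)[OF l(3)] L(2) by auto
        ultimately have "(w l, w (Suc l)) \<in> B" using M(3) by blast
        moreover have "(\<rho> (Suc j) l, \<rho> (Suc j) (Suc l)) \<in> B" using \<rho>(2)[of "Suc j" l] l j sub by auto
        ultimately show "(w l, w (Suc l)) \<in> B \<and> (\<rho> (Suc j) l, \<rho> (Suc j) (Suc l)) \<in> B" by simp
      next
        show "w 0 = \<rho> (Suc j) 0" using \<rho>(1)[of "Suc j"] j by (simp add: w_def)
        show "f (w l) = f (\<rho> (Suc j) l)" if "l \<le> i" for l
          using w(2)[of l] \<rho>(3)[of "Suc j" l] i j that by simp
      qed
      then show ?thesis using K2(3) w(1)[OF i] sub by blast
    qed
    have right_close: "(\<rho> 0 n, \<rho> j n) \<in> E" if j: "j \<le> m" for j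
    proof (rule Auniq[where c="\<lambda>_. \<rho> 0 n" and d="\<lambda>j. \<rho> j n"])
      fix i assume "i < j"
      then show "(\<rho> 0 n, \<rho> 0 n) \<in> A \<and> (\<rho> i n, \<rho> (Suc i) n) \<in> A"
        using col[of i n] K(2) entourage_refl[OF A] j by auto
    next
      show "f (\<rho> 0 n) = f (\<rho> i n)" if "i \<le> j" for i
        using \<rho>(3)[of 0 n] \<rho>(3)[of i n] right[of i] j that by simp
    qed simp
    have col': "(\<rho> j i, \<rho> j' i) \<in> K" if asm: "j \<le> m" "j' \<le> m" "j \<le> Suc j'" "j' \<le> Suc j" "i \<le> n" for j j' i
    proof -
      consider "j = j'" | "j' = Suc j" "j < m" | "j = Suc j'" "j' < m" using asm by linarith
      then show ?thesis
      proof cases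
        case 1 then show ?thesis by (simp add: entourage_refl[OF K(1)])
      next
        case 2 then show ?thesis using col asm by simp
      next
        case 3 then show ?thesis using entourage_sym[OF K(1) col[of j' i]] asm by simp
      qed
    qed
    have row': "(\<rho> j i, \<rho> j i') \<in> K" if asm: "j \<le> m" "i \<le> n" "i' \<le> n" "i \<le> Suc i'" "i' \<le> Suc i" for j i i'
    proof -
      consider "i = i'" | "i' = Suc i" "i < n" | "i = Suc i'" "i' < n" using asm by linarith
      then show ?thesis
      proof cases
        case 1 then show ?thesis by (simp add: entourage_refl[OF K(1)])
      next
        case 2 then show ?thesis using \<rho>(2)[OF asm(1)] sub by auto
      next
        case 3
        then have "(\<rho> j i', \<rho> j i) \<in> K" using \<rho>(2)[OF asm(1)] sub by auto
        then show ?thesis by (rule entourage_sym[OF K(1)])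
      qed
    qed
    have "(\<rho> j i, \<rho> j' i') \<in> E" if "j \<le> m" "i \<le> n" "j' \<le> m" "i' \<le> n"
        "j \<le> Suc j'" "j' \<le> Suc j" "i \<le> Suc i'" "i' \<le> Suc i" for j i j' i'
      using K(3)[OF col'[of j j' i] row'[of j' i i']] that by blast
    moreover have "\<rho> 0 = \<psi>0" "\<rho> m = \<psi>1" using m by (auto simp: \<rho>_def)
    ultimately show "\<exists>\<rho>. \<rho> 0 = \<psi>0 \<and> \<rho> m = \<psi>1 \<and>
        (\<forall>j\<le>m. \<rho> j 0 = \<psi>0 0 \<and> (\<psi>0 n, \<rho> j n) \<in> E) \<and>
        (\<forall>j\<le>m. \<forall>i\<le>n. \<forall>j'\<le>m. \<forall>i'\<le>n.
          j \<le> Suc j' \<longrightarrow> j' \<le> Suc j \<longrightarrow> i \<le> Suc i' \<longrightarrow> i' \<le> Suc i \<longrightarrow> (\<rho> j i, \<rho> j' i') \<in> E)"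
      using right_close \<rho>(1) by (intro exI[of _ \<rho>]) (simp add: x_def)
  qed
  then show ?thesis using F sub by blast
qed

text \<open>
  Closeness of the end points is what makes the end points of lifts converge; homotopy for equal end
  points makes the class of a lift with given end point well defined.
\<close>

definition homotopy_lifting :: "('a \<times> 'a) set \<Rightarrow> ('a \<times> 'a) set \<Rightarrow> bool" where
  "homotopy_lifting E F \<longleftrightarrow> (\<forall>n0 n1 \<psi>0 \<psi>1. 0 < n0 \<longrightarrow> 0 < n1 \<longrightarrow> \<psi>0 0 = \<psi>1 0 \<longrightarrow>
      (\<forall>i<n0. (\<psi>0 i, \<psi>0 (Suc i)) \<in> F) \<longrightarrow> (\<forall>i<n1. (\<psi>1 i, \<psi>1 (Suc i)) \<in> F) \<longrightarrow>
      homotopic_rel_ends (realization (rips_complex (range f) (map_prod f f ` F)))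
        (edge_path n0 (f \<circ> \<psi>0)) (edge_path n1 (f \<circ> \<psi>1)) \<longrightarrow>
      (\<psi>0 n0, \<psi>1 n1) \<in> E \<and>
      (\<psi>0 n0 = \<psi>1 n1 \<longrightarrow> homotopic_rel_ends (realization (rips_complex UNIV E))
        (edge_path n0 \<psi>0) (edge_path n1 \<psi>1)))"

text \<open>
  The homotopy of the images is turned into a grid, which is lifted. If the two chains end at the same
  point, all entries of the right column of the lift are close to it and may be replaced by it; the
  result spans a homotopy relative to the end points.
\<close>

lemma ex_homotopy_lifting:
  assumes E: "E \<in> entourages"
  shows "\<exists>F\<in>entourages. F \<subseteq> E \<and> homotopy_lifting E F"
proof -
  obtain E' where E': "E' \<in> entourages" "E' \<subseteq> E"
      "\<And>x y z. (x, y) \<in> E' \<Longrightarrow> (y, z) \<in> E' \<Longrightarrow> (x, z) \<in> E"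
    using entourage_halfE[OF E] by metis
  obtain F where F: "F \<in> entourages" "F \<subseteq> E'" and grid: "grid_lifting E' F"
    using ex_grid_lifting[OF E'(1)] by blast
  have "homotopy_lifting E F"
    unfolding homotopy_lifting_def
  proof (intro allI impI)
    fix n0 n1 \<psi>0 \<psi>1
    assume pos: "0 < n0" "0 < n1" and start: "\<psi>0 0 = \<psi>1 0"
      and "\<forall>i<n0. (\<psi>0 i, \<psi>0 (Suc i)) \<in> F" "\<forall>i<n1. (\<psi>1 i, \<psi>1 (Suc i)) \<in> F"
      and hom: "homotopic_rel_ends (realization (rips_complex (range f) (map_prod f f ` F)))
        (edge_path n0 (f \<circ> \<psi>0)) (edge_path n1 (f \<circ> \<psi>1))"
    then have \<psi>0: "\<And>i. i < n0 \<Longrightarrow> (\<psi>0 i, \<psi>0 (Suc i)) \<in> F"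
      and \<psi>1: "\<And>i. i < n1 \<Longrightarrow> (\<psi>1 i, \<psi>1 (Suc i)) \<in> F" by blast+
    obtain k k' n m \<phi> where kk: "0 < k" "0 < k'" "n = n0 * k" "n = n1 * k'" "0 < m"
      and \<phi>: "\<phi> 0 = (\<lambda>i. (f \<circ> \<psi>0) (i div k))" "\<phi> m = (\<lambda>i. (f \<circ> \<psi>1) (i div k'))"
      and ends: "\<And>j. j \<le> m \<Longrightarrow> \<phi> j 0 = f (\<psi>0 0)" "\<And>j. j \<le> m \<Longrightarrow> \<phi> j n = f (\<psi>0 n0)"
      and hor: "\<And>j i. j \<le> m \<Longrightarrow> i < n \<Longrightarrow> (\<phi> j i, \<phi> j (Suc i)) \<in> map_prod f f ` F"
      and ver: "\<And>j i. j < m \<Longrightarrow> i \<le> n \<Longrightarrow> (\<phi> j i, \<phi> (Suc j) i) \<in> map_prod f f ` F"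
    proof (rule homotopy_grid[OF hom edge_path_approximates edge_path_approximates pos])
      show "edge_path n0 (f \<circ> \<psi>0) 0 = vertex_pt (f (\<psi>0 0))" by (simp add: edge_path_0)
      show "edge_path n0 (f \<circ> \<psi>0) 1 = vertex_pt (f (\<psi>0 n0))" by (simp add: edge_path_1)
    qed (rule that; assumption)
    define c0 c1 where "c0 = (\<lambda>i. \<psi>0 (i div k))" and "c1 = (\<lambda>i. \<psi>1 (i div k'))"
    have cn: "c0 n = \<psi>0 n0" "c1 n = \<psi>1 n1"
    proof -
      have "n div k = n0" using kk(1,3) by simp
      then show "c0 n = \<psi>0 n0" by (simp add: c0_def)
      have "n div k' = n1" using kk(2,4) by simp
      then show "c1 n = \<psi>1 n1" by (simp add: c1_def)
    qed
    have c0: "(c0 i, c0 (Suc i)) \<in> F" and c1: "(c1 i, c1 (Suc i)) \<in> F" if "i < n" for i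
      unfolding c0_def c1_def
      using refined_chain[of F n0 \<psi>0 i k, OF entourage_refl[OF F(1)] \<psi>0 that[unfolded kk(3)]]
        refined_chain[of F n1 \<psi>1 i k', OF entourage_refl[OF F(1)] \<psi>1 that[unfolded kk(4)]]
      by simp_all
    have "\<exists>\<rho>. \<rho> 0 = c0 \<and> \<rho> m = c1 \<and> (\<forall>j\<le>m. \<rho> j 0 = c0 0 \<and> (c0 n, \<rho> j n) \<in> E') \<and>
        (\<forall>j\<le>m. \<forall>i\<le>n. \<forall>j'\<le>m. \<forall>i'\<le>n.
          j \<le> Suc j' \<longrightarrow> j' \<le> Suc j \<longrightarrow> i \<le> Suc i' \<longrightarrow> i' \<le> Suc i \<longrightarrow> (\<rho> j i, \<rho> j' i') \<in> E')"
    proof (rule grid[unfolded grid_lifting_def, rule_format, where \<phi>=\<phi>])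
      show "\<phi> j 0 = \<phi> 0 0 \<and> \<phi> j n = \<phi> 0 n" if "j \<le> m" for j
        using ends[OF that] ends[of 0] by simp
      show "(c0 i, c0 (Suc i)) \<in> F \<and> (c1 i, c1 (Suc i)) \<in> F" if "i < n" for i
        using c0 c1 that by blast
      show "c0 0 = c1 0" using start by (simp add: c0_def c1_def)
      show "f (c0 i) = \<phi> 0 i \<and> f (c1 i) = \<phi> m i" for i
        by (simp add: \<phi> c0_def c1_def)
    qed (fact kk(5) hor ver)+
    then obtain \<rho> where "\<rho> 0 = c0 \<and> \<rho> m = c1 \<and> (\<forall>j\<le>m. \<rho> j 0 = c0 0 \<and> (c0 n, \<rho> j n) \<in> E') \<and>
        (\<forall>j\<le>m. \<forall>i\<le>n. \<forall>j'\<le>m. \<forall>i'\<le>n.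
          j \<le> Suc j' \<longrightarrow> j' \<le> Suc j \<longrightarrow> i \<le> Suc i' \<longrightarrow> i' \<le> Suc i \<longrightarrow> (\<rho> j i, \<rho> j' i') \<in> E')" ..
    then have \<rho>: "\<rho> 0 = c0" "\<rho> m = c1" "\<And>j. j \<le> m \<Longrightarrow> \<rho> j 0 = c0 0"
        "\<And>j. j \<le> m \<Longrightarrow> (c0 n, \<rho> j n) \<in> E'"
      and adj: "\<And>j i j' i'. j \<le> m \<Longrightarrow> i \<le> n \<Longrightarrow> j' \<le> m \<Longrightarrow> i' \<le> n \<Longrightarrow>
        j \<le> Suc j' \<Longrightarrow> j' \<le> Suc j \<Longrightarrow> i \<le> Suc i' \<Longrightarrow> i' \<le> Suc i \<Longrightarrow> (\<rho> j i, \<rho> j' i') \<in> E'"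
      by simp_all
    show "(\<psi>0 n0, \<psi>1 n1) \<in> E \<and>
      (\<psi>0 n0 = \<psi>1 n1 \<longrightarrow> homotopic_rel_ends (realization (rips_complex UNIV E))
        (edge_path n0 \<psi>0) (edge_path n1 \<psi>1))"
    proof (intro conjI impI)
      show "(\<psi>0 n0, \<psi>1 n1) \<in> E" using \<rho>(4)[of m] E'(2) cn by (auto simp: \<rho>(2))
      assume eq: "\<psi>0 n0 = \<psi>1 n1"
      let ?R = "realization (rips_complex UNIV E)"
      \<comment> \<open>Overwriting the right column costs one more step, hence \<open>E'\<close> instead of \<open>E\<close>.\<close>
      define \<sigma> where "\<sigma> j = (\<rho> j)(n := \<psi>0 n0)" for j
      have n: "n \<noteq> 0" using kk pos by simp
      have "homotopic_rel_ends ?R (edge_path n (\<sigma> 0)) (edge_path n (\<sigma> m))"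
      proof (rule grid_homotopic)
        fix j i j' i' assume *: "j \<le> m" "i \<le> n" "j' \<le> m" "i' \<le> n"
          "j \<le> Suc j'" "j' \<le> Suc j" "i \<le> Suc i'" "i' \<le> Suc i"
        have r: "(\<rho> j i, \<rho> j' i') \<in> E'" by (rule adj[OF *])
        have e: "(\<psi>0 n0, \<rho> j n) \<in> E'" "(\<psi>0 n0, \<rho> j' n) \<in> E'" using \<rho>(4)[OF *(1)] \<rho>(4)[OF *(3)] cn by simp_all
        consider "i = n" "i' = n" | "i = n" "i' \<noteq> n" | "i \<noteq> n" "i' = n" | "i \<noteq> n" "i' \<noteq> n" by blast
        then show "(\<sigma> j i, \<sigma> j' i') \<in> E"
        proof cases
          case 1 then show ?thesis using entourage_refl[OF E] by (simp add: \<sigma>_def)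
        next
          case 2 then show ?thesis using E'(3)[OF e(1)] r by (simp add: \<sigma>_def)
        next
          case 3 then show ?thesis
            using E'(3)[OF r] entourage_sym[OF E'(1) e(2)] by (simp add: \<sigma>_def)
        next
          case 4 then show ?thesis using r E'(2) by (auto simp: \<sigma>_def)
        qed
      next
        show "\<sigma> j 0 = \<sigma> 0 0" if "j \<le> m" for j using \<rho>(1) \<rho>(3)[OF that] n by (simp add: \<sigma>_def)
        show "\<sigma> j n = \<sigma> 0 n" for j by (simp add: \<sigma>_def)
      qed simp
      moreover have "\<sigma> 0 = c0" "\<sigma> m = c1"
        using cn eq by (simp_all add: \<sigma>_def \<rho>(1,2) fun_upd_idem)
      ultimately have mid: "homotopic_rel_ends ?R (edge_path n c0) (edge_path n c1)" by simp
      have refine: "homotopic_rel_ends ?R (edge_path l \<psi>) (edge_path (l * k) (\<lambda>i. \<psi> (i div k)))"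
        if "0 < k" "\<And>i. i < l \<Longrightarrow> (\<psi> i, \<psi> (Suc i)) \<in> F" for l k \<psi>
      proof (rule homotopic_approximation[OF _ edge_path_0 edge_path_1])
        show "pathin ?R (edge_path l \<psi>)"
          using that F(2) E'(2) by (intro pathin_edge_path_chain[OF E]) blast
        show "approximates (l * k) (\<lambda>i. \<psi> (i div k)) (edge_path l \<psi>)"
          using edge_path_approximates that(1) by (rule approximates_refine)
      qed
      have h0: "homotopic_rel_ends ?R (edge_path n0 \<psi>0) (edge_path n c0)"
        using refine[where k=k and l=n0 and \<psi>=\<psi>0, OF kk(1) \<psi>0] kk(3) by (simp add: c0_def)
      have h1: "homotopic_rel_ends ?R (edge_path n1 \<psi>1) (edge_path n c1)"
        using refine[where k=k' and l=n1 and \<psi>=\<psi>1, OF kk(2) \<psi>1] kk(4) by (simp add: c1_def)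
      show "homotopic_rel_ends ?R (edge_path n0 \<psi>0) (edge_path n1 \<psi>1)"
        using homotopic_rel_ends_trans[OF homotopic_rel_ends_trans[OF h0 mid] homotopic_rel_ends_sym[OF h1]] .
    qed
  qed
  then show ?thesis using F E'(2) by blast
qed

end

section \<open>Lifting generalized paths\<close>

lemma generalized_path_mem_iff:
  assumes d: "generalized_path Y \<V> a b d" and D: "D \<in> \<V>" and q: "q \<in> d D"
  shows "d D = path_class (realization (rips_complex Y D)) q"
    and "r \<in> d D \<longleftrightarrow> homotopic_rel_ends (realization (rips_complex Y D)) q r"
proof -
  obtain q0 where q0: "d D = path_class (realization (rips_complex Y D)) q0"
    using d D by (auto simp: generalized_path_def)
  have "homotopic_rel_ends (realization (rips_complex Y D)) q0 q"
    using q by (simp add: q0 path_class_def)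
  then have "homotopic_rel_ends (realization (rips_complex Y D)) q0 r \<longleftrightarrow>
      homotopic_rel_ends (realization (rips_complex Y D)) q r" for r
    using homotopic_rel_ends_sym homotopic_rel_ends_trans by metis
  then show "d D = path_class (realization (rips_complex Y D)) q"
    and "r \<in> d D \<longleftrightarrow> homotopic_rel_ends (realization (rips_complex Y D)) q r"
    by (simp_all add: q0 path_class_def)
qed

lemma generalized_path_rep:
  assumes d: "generalized_path Y \<V> a b d" and D: "D \<in> \<V>"
  shows "\<exists>q\<in>d D. path_between (realization (rips_complex Y D)) (vertex_pt a) (vertex_pt b) q"
proof -
  obtain q where q: "path_between (realization (rips_complex Y D)) (vertex_pt a) (vertex_pt b) q"
      "d D = path_class (realization (rips_complex Y D)) q"
    using d D by (auto simp: generalized_path_def)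
  then have "q \<in> d D"
    by (simp add: path_class_def path_between_def homotopic_rel_ends_refl)
  then show ?thesis using q(1) by blast
qed

lemma generalized_path_mono:
  assumes d: "generalized_path Y \<V> a b d" and D: "D \<in> \<V>" "D' \<in> \<V>" "D' \<subseteq> D" and q: "q \<in> d D'"
  shows "q \<in> d D"
proof -
  obtain r where r: "r \<in> d D" using generalized_path_rep[OF d D(1)] by blast
  have "homotopic_rel_ends (realization (rips_complex Y D)) q r"
    using d D q r unfolding generalized_path_def by blast
  then show ?thesis
    using generalized_path_mem_iff(2)[OF d D(1) r] homotopic_rel_ends_sym by blast
qed

context chain_covering
begin

text \<open>
  The limit \<open>x\<close> of the end points of fine lifts is the end point of the lifted generalized path, and at
  the scale \<open>E\<close> this path is represented by any lift ending at \<open>x\<close> that is fine enough for homotopies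
  to lift to the scale \<open>E\<close>.
\<close>

theorem generalized_path_lifting_complete_fibers:
  assumes gen: "generates_uniform_structure entourages \<V> f"
    and complete: "\<And>y. y \<in> range f \<Longrightarrow> complete (f -` {y})"
  shows "generalized_path_lifting UNIV entourages (range f) \<V> f"
  unfolding generalized_path_lifting_def
proof (intro ballI allI impI)
  fix x0 y d assume d: "generalized_path (range f) \<V> (f x0) y d"
  let ?RY = "\<lambda>E. realization (rips_complex (range f) (map_prod f f ` E))"
  let ?RX = "\<lambda>E. realization (rips_complex UNIV E)"
  have V: "map_prod f f ` E \<in> \<V>" if "E \<in> entourages" for E
    using gen that by (auto simp: generates_uniform_structure_def)
  have y: "y \<in> range f" using d by (simp add: generalized_path_def)
  \<comment> \<open>The lifts that serve to construct the end point; they may end anywhere in the fiber over \<open>y\<close>.\<close>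
  define L where "L E = {(n, \<psi>). 0 < n \<and> \<psi> 0 = x0 \<and> (\<forall>i<n. (\<psi> i, \<psi> (Suc i)) \<in> E) \<and>
      f (\<psi> n) = y \<and> edge_path n (f \<circ> \<psi>) \<in> d (map_prod f f ` E)}" for E
  have L_mono: "L F \<subseteq> L E" if "E \<in> entourages" "F \<in> entourages" "F \<subseteq> E" for E F
    using that generalized_path_mono[OF d V V, of E F] image_mono[of F E "map_prod f f"]
    unfolding L_def by blast
  have L_ne: "L E \<noteq> {}" if E: "E \<in> entourages" for E
  proof -
    obtain F1 where F1: "F1 \<in> entourages"
        "\<And>x y. (f x, y) \<in> map_prod f f ` F1 \<Longrightarrow> \<exists>x'. (x, x') \<in> E \<and> f x' = y"
      using step_lifting[OF E] by blast
    define F where "F = F1 \<inter> E"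
    have F: "F \<in> entourages" "F \<subseteq> E" using F1(1) E by (auto simp: F_def intro: entourage_Int)
    have lift: "\<exists>x'. (x, x') \<in> E \<and> f x' = y" if "(f x, y) \<in> map_prod f f ` F" for x y
      by (rule F1(2)) (use that in \<open>auto simp: F_def\<close>)
    obtain q where q: "q \<in> d (map_prod f f ` F)" "pathin (?RY F) q"
        "q 0 = vertex_pt (f x0)" "q 1 = vertex_pt y"
      using generalized_path_rep[OF d V[OF F(1)]] by (auto simp: path_between_def)
    obtain n c where n: "0 < n" and c: "approximates n c q"
      using path_approximation[OF q(2)] by blast
    have ends: "f x0 = c 0" "c n = y" using approximates_ends[OF c] q(3,4) by simp_all
    have "(c i, c (Suc i)) \<in> map_prod f f ` F" if "i < n" for i
      using approximates_adjacent(1)[OF q(2) c, of i "Suc i"] that by simp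
    from lift_chain[where D="map_prod f f ` F", OF lift ends(1) this]
    obtain \<psi> where \<psi>: "\<psi> 0 = x0" "\<forall>i<n. (\<psi> i, \<psi> (Suc i)) \<in> E" "\<forall>i\<le>n. f (\<psi> i) = c i" by blast
    have "edge_path n c \<in> d (map_prod f f ` F)"
      using homotopic_approximation[OF q(2-4) c] generalized_path_mem_iff(2)[OF d V[OF F(1)] q(1)]
      by simp
    then have "edge_path n c \<in> d (map_prod f f ` E)"
      by (rule generalized_path_mono[OF d V[OF E] V[OF F(1)] image_mono[OF F(2)]])
    moreover have "edge_path n (f \<circ> \<psi>) = edge_path n c"
      using \<psi>(3) by (intro edge_path_cong) simp
    ultimately have "(n, \<psi>) \<in> L E" using n \<psi> ends by (simp add: L_def)
    then show ?thesis by blast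
  qed
  have lift: "(\<psi>0 n0, \<psi>1 n1) \<in> E \<and>
      (\<psi>0 n0 = \<psi>1 n1 \<longrightarrow> homotopic_rel_ends (?RX E) (edge_path n0 \<psi>0) (edge_path n1 \<psi>1))"
    if F: "F \<in> entourages" "homotopy_lifting E F" and "(n0, \<psi>0) \<in> L F" "(n1, \<psi>1) \<in> L F"
    for E F n0 n1 \<psi>0 \<psi>1
  proof (rule F(2)[unfolded homotopy_lifting_def, rule_format])
    show "homotopic_rel_ends (?RY F) (edge_path n0 (f \<circ> \<psi>0)) (edge_path n1 (f \<circ> \<psi>1))"
      using generalized_path_mem_iff(2)[OF d V[OF F(1)], of "edge_path n0 (f \<circ> \<psi>0)"] that(3,4)
      by (simp add: L_def)
  qed (use that(3,4) in \<open>auto simp: L_def\<close>)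
  \<comment> \<open>The end points of these chains generate a Cauchy filter on the fiber.\<close>
  define T where "T E = (\<lambda>(n, \<psi>). \<psi> n) ` L E" for E
  have "\<exists>x\<in>f -` {y}. \<forall>E\<in>entourages. \<exists>F\<in>entourages. \<forall>z\<in>T F. (z, x) \<in> E"
  proof (rule cauchy_family_limit[OF complete[OF y]])
    fix E :: "('a \<times> 'a) set" assume E: "E \<in> entourages"
    show "T E \<noteq> {}" using L_ne[OF E] by (simp add: T_def)
    show "T E \<subseteq> f -` {y}" by (auto simp: T_def L_def)
    show "T F \<subseteq> T E" if "F \<in> entourages" "F \<subseteq> E" for F
      unfolding T_def by (rule image_mono[OF L_mono[OF E that]])
    obtain F where "F \<in> entourages" "homotopy_lifting E F" using ex_homotopy_lifting[OF E] by blast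
    then have "T F \<times> T F \<subseteq> E" using lift[of F E] by (auto simp: T_def)
    then show "\<exists>F\<in>entourages. T F \<times> T F \<subseteq> E" using \<open>F \<in> entourages\<close> by blast
  qed
  then obtain x where x: "f x = y" and lim: "\<And>E. E \<in> entourages \<Longrightarrow> \<exists>F\<in>entourages. \<forall>z\<in>T F. (z, x) \<in> E"
    by auto
  define M where "M E = {(n, \<psi>) \<in> L E. \<psi> n = x}" for E
  have M_mono: "M F \<subseteq> M E" if "E \<in> entourages" "F \<in> entourages" "F \<subseteq> E" for E F
    using L_mono[OF that] by (auto simp: M_def)
  have M_ne: "M E \<noteq> {}" if E: "E \<in> entourages" for E
  proof -
    obtain K where K: "K \<in> entourages" "K \<subseteq> E" "\<And>x y z. (x, y) \<in> K \<Longrightarrow> (y, z) \<in> K \<Longrightarrow> (x, z) \<in> E"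
      using entourage_halfE[OF E] by metis
    obtain F where F: "F \<in> entourages" "\<forall>z\<in>T F. (z, x) \<in> K" using lim[OF K(1)] by blast
    have FK: "F \<inter> K \<in> entourages" using F(1) K(1) by (rule entourage_Int)
    obtain n \<psi> where n\<psi>: "(n, \<psi>) \<in> L (F \<inter> K)" using L_ne[OF FK] by auto
    then have "(n, \<psi>) \<in> L F" using L_mono[OF F(1) FK] by blast
    then have "\<psi> n \<in> T F" by (force simp: T_def)
    then have last: "(\<psi> n, x) \<in> K" using F(2) by blast
    have "(n, \<psi>) \<in> L E" using L_mono[OF E FK] K(2) n\<psi> by blast
    then have \<psi>: "0 < n" "\<psi> 0 = x0" "f (\<psi> n) = y" "edge_path n (f \<circ> \<psi>) \<in> d (map_prod f f ` E)"
      by (auto simp: L_def)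
    have steps: "(\<psi> i, \<psi> (Suc i)) \<in> K" if "i < n" for i using n\<psi> that by (auto simp: L_def)
    \<comment> \<open>The point \<open>x\<close> lies over \<open>y\<close>, so the image of the chain is unchanged.\<close>
    define \<psi>' where "\<psi>' = \<psi>(n := x)"
    have "(\<psi>' i, \<psi>' (Suc i)) \<in> E" if "i < n" for i
    proof (cases "Suc i = n")
      case True
      then show ?thesis using K(3)[OF steps[OF that]] last that by (auto simp: \<psi>'_def)
    next
      case False
      then show ?thesis using steps[OF that] K(2) that by (auto simp: \<psi>'_def)
    qed
    moreover have "edge_path n (f \<circ> \<psi>') = edge_path n (f \<circ> \<psi>)"
      using x \<psi>(3) by (intro edge_path_cong) (simp add: \<psi>'_def)
    ultimately have "(n, \<psi>') \<in> M E" using \<psi> x by (simp add: M_def L_def \<psi>'_def)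
    then show ?thesis by blast
  qed
  have "\<exists>F\<in>entourages. F \<subseteq> E \<and> homotopy_lifting E F" if "E \<in> entourages" for E
    using that by (rule ex_homotopy_lifting)
  \<comment> \<open>At the scale \<open>\<Gamma> E\<close> all chains in \<open>M\<close> are homotopic in the Rips complex of scale \<open>E\<close>.\<close>
  then obtain \<Gamma> where \<Gamma>: "\<And>E. E \<in> entourages \<Longrightarrow> \<Gamma> E \<in> entourages"
      "\<And>E. E \<in> entourages \<Longrightarrow> \<Gamma> E \<subseteq> E" "\<And>E. E \<in> entourages \<Longrightarrow> homotopy_lifting E (\<Gamma> E)"
    by metis
  have "\<exists>q. \<forall>n \<psi>. (n, \<psi>) \<in> M (\<Gamma> E) \<longrightarrow> homotopic_rel_ends (?RX E) q (edge_path n \<psi>)"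
    if E: "E \<in> entourages" for E
  proof -
    obtain n \<psi> where n\<psi>: "(n, \<psi>) \<in> M (\<Gamma> E)" using M_ne[OF \<Gamma>(1)[OF E]] by auto
    have "homotopic_rel_ends (?RX E) (edge_path n \<psi>) (edge_path n' \<psi>')" if "(n', \<psi>') \<in> M (\<Gamma> E)" for n' \<psi>'
      using lift[OF \<Gamma>(1)[OF E] \<Gamma>(3)[OF E], of n \<psi> n' \<psi>'] n\<psi> that by (simp add: M_def)
    then show ?thesis by blast
  qed
  then obtain q where q: "\<And>E n \<psi>. E \<in> entourages \<Longrightarrow> (n, \<psi>) \<in> M (\<Gamma> E) \<Longrightarrow>
      homotopic_rel_ends (?RX E) (q E) (edge_path n \<psi>)"
    by metis
  define c where "c E = path_class (?RX E) (q E)" for E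
  have gp: "generalized_path UNIV entourages x0 x c"
    unfolding generalized_path_def
  proof (intro conjI ballI impI)
    fix E :: "('a \<times> 'a) set" assume E: "E \<in> entourages"
    obtain n \<psi> where n\<psi>: "(n, \<psi>) \<in> M (\<Gamma> E)" using M_ne[OF \<Gamma>(1)[OF E]] by auto
    note hom = q[OF E n\<psi>]
    have "path_between (?RX E) (vertex_pt x0) (vertex_pt x) (q E)"
      using homotopic_rel_ends_imp[OF hom] n\<psi>
      by (simp add: path_between_def edge_path_0 edge_path_1 M_def L_def)
    then show "\<exists>r. path_between (?RX E) (vertex_pt x0) (vertex_pt x) r \<and> c E = path_class (?RX E) r"
      by (auto simp: c_def)
  next
    fix E F :: "('a \<times> 'a) set" and r s
    assume E: "E \<in> entourages" and F: "F \<in> entourages" and FE: "F \<subseteq> E" and r: "r \<in> c F" and s: "s \<in> c E"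
    \<comment> \<open>A chain in \<open>M\<close> at a common finer scale represents both classes.\<close>
    have int: "\<Gamma> E \<inter> \<Gamma> F \<in> entourages" using \<Gamma>(1) E F by (intro entourage_Int)
    obtain n \<psi> where "(n, \<psi>) \<in> M (\<Gamma> E \<inter> \<Gamma> F)" using M_ne[OF int] by auto
    then have mem: "(n, \<psi>) \<in> M (\<Gamma> E)" "(n, \<psi>) \<in> M (\<Gamma> F)"
      using M_mono[OF \<Gamma>(1)[OF E] int] M_mono[OF \<Gamma>(1)[OF F] int] by auto
    have "homotopic_rel_ends (?RX E) (q E) s" "homotopic_rel_ends (?RX F) (q F) r"
      using r s by (simp_all add: c_def path_class_def)
    moreover note q[OF E mem(1)] q[OF F mem(2)]
    moreover note homotopic_rel_ends_rips_mono[OF _ FE]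
    ultimately show "homotopic_rel_ends (?RX E) r s"
      by (meson homotopic_rel_ends_sym homotopic_rel_ends_trans)
  qed simp_all
  moreover have "image_path entourages (range f) f c D = d D" if D: "D \<in> \<V>" for D
  proof -
    have eq: "path_class (realization (rips_complex (range f) D)) (realization_map f \<circ> r) = d D"
      if E: "E \<in> entourages" "map_prod f f ` E \<subseteq> D" and r: "r \<in> c E" for E r
    proof -
      obtain n \<psi> where n\<psi>: "(n, \<psi>) \<in> M (\<Gamma> E)" using M_ne[OF \<Gamma>(1)[OF E(1)]] by auto
      have "homotopic_rel_ends (?RX E) (q E) r" using r by (simp add: c_def path_class_def)
      then have "homotopic_rel_ends (?RX E) (edge_path n \<psi>) r"
        using homotopic_rel_ends_trans[OF homotopic_rel_ends_sym[OF q[OF E(1) n\<psi>]]] by blast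
      from homotopic_rel_ends_compose[OF this continuous_map_realization_map[OF order_refl E(2)]]
      have hom: "homotopic_rel_ends (realization (rips_complex (range f) D))
          (edge_path n (f \<circ> \<psi>)) (realization_map f \<circ> r)"
        by (simp add: realization_map_edge_path)
      have "edge_path n (f \<circ> \<psi>) \<in> d (map_prod f f ` \<Gamma> E)"
        using n\<psi> by (simp add: M_def L_def)
      moreover have "map_prod f f ` \<Gamma> E \<subseteq> D" using \<Gamma>(2)[OF E(1)] E(2) by blast
      ultimately have "edge_path n (f \<circ> \<psi>) \<in> d D"
        using generalized_path_mono[OF d D V[OF \<Gamma>(1)[OF E(1)]]] by blast
      then have "realization_map f \<circ> r \<in> d D"
        using generalized_path_mem_iff(2)[OF d D] hom by blast
      then show ?thesis using generalized_path_mem_iff(1)[OF d D] by simp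
    qed
    obtain E where E: "E \<in> entourages" "map_prod f f ` E \<subseteq> D"
      using gen D by (auto simp: generates_uniform_structure_def)
    obtain r where "r \<in> c E" using generalized_path_rep[OF gp E(1)] by blast
    then show ?thesis
      unfolding image_path_def using eq E by blast
  qed
  ultimately show "\<exists>x c. generalized_path UNIV entourages x0 x c \<and> f x = y \<and>
      (\<forall>F\<in>\<V>. image_path entourages (range f) f c F = d F)"
    using x by blast
qed

end

section \<open>The covering properties\<close>

context chain_covering
begin

lemma generated_entourages_image:
  assumes "E \<in> entourages"
  shows "map_prod f f ` E \<in> generated_entourages entourages (range f) f"
proof -
  have "sym (map_prod f f ` E)"
  proof (rule symI)
    fix a b assume "(a, b) \<in> map_prod f f ` E"
    then obtain x y where "(x, y) \<in> E" "a = f x" "b = f y" by auto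
    then have "map_prod f f (y, x) \<in> map_prod f f ` E" "(b, a) = map_prod f f (y, x)"
      using entourage_sym[OF assms] by auto
    then show "(b, a) \<in> map_prod f f ` E" by simp
  qed
  then show ?thesis using assms by (auto simp: generated_entourages_def)
qed

lemma generates_generated_entourages:
  "generates_uniform_structure entourages (generated_entourages entourages (range f) f) f"
  unfolding generates_uniform_structure_def
  using generated_entourages_image by (auto simp: generated_entourages_def)

text \<open>
  In general the sets \<open>f(E)\<close> are not a base of a uniform structure, since the middle points of two
  consecutive steps in \<open>f(F)\<close> need only agree after applying \<open>f\<close>. Lifting the second step from the
  end point of the first one repairs this.
\<close>

lemma uniform_structure_generated_entourages:
  "uniform_structure (range f) (generated_entourages entourages (range f) f)"
  unfolding uniform_structure_def
proof (intro conjI ballI allI impI)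
  let ?V = "generated_entourages entourages (range f) f"
  have "(UNIV :: ('a \<times> 'a) set) \<in> entourages" by (simp add: entourages_def sym_def)
  from generated_entourages_image[OF this] show "?V \<noteq> {}" by auto
next
  fix D assume D: "D \<in> generated_entourages entourages (range f) f"
  then obtain E where E: "E \<in> entourages" "map_prod f f ` E \<subseteq> D"
    by (auto simp: generated_entourages_def)
  show "D \<subseteq> range f \<times> range f" "sym D"
    using D by (auto simp: generated_entourages_def)
  show "Id_on (range f) \<subseteq> D"
  proof
    fix z assume "z \<in> Id_on (range f)"
    then obtain x where "z = map_prod f f (x, x)" by auto
    then show "z \<in> D" using E(2) entourage_refl[OF E(1), of x] by blast
  qed
  obtain K where K: "K \<in> entourages" "K \<subseteq> E" "\<And>x y z. (x, y) \<in> K \<Longrightarrow> (y, z) \<in> K \<Longrightarrow> (x, z) \<in> E"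
    using entourage_halfE[OF E(1)] by metis
  obtain F1 where F1: "F1 \<in> entourages"
      "\<And>x y. (f x, y) \<in> map_prod f f ` F1 \<Longrightarrow> \<exists>x'. (x, x') \<in> K \<and> f x' = y"
    using step_lifting[OF K(1)] by blast
  have F: "F1 \<inter> K \<in> entourages" using F1(1) K(1) by (rule entourage_Int)
  have "map_prod f f ` (F1 \<inter> K) O map_prod f f ` (F1 \<inter> K) \<subseteq> D"
  proof (rule subrelI)
    fix u w assume "(u, w) \<in> map_prod f f ` (F1 \<inter> K) O map_prod f f ` (F1 \<inter> K)"
    then obtain v where "(u, v) \<in> map_prod f f ` (F1 \<inter> K)" and vw: "(v, w) \<in> map_prod f f ` (F1 \<inter> K)"
      by (rule relcompEpair)
    then obtain a b where ab: "(a, b) \<in> K" "u = f a" "v = f b" by auto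
    have "(f b, w) \<in> map_prod f f ` F1"
      using vw unfolding ab(3) by (rule subsetD[OF image_mono[OF Int_lower1]])
    from F1(2)[OF this] obtain c where c: "(b, c) \<in> K" "f c = w" by blast
    have "map_prod f f (a, c) \<in> D"
      by (rule subsetD[OF E(2) imageI[OF K(3)[OF ab(1) c(1)]]])
    then show "(u, w) \<in> D" using ab c by simp
  qed
  then show "\<exists>F\<in>generated_entourages entourages (range f) f. F O F \<subseteq> D"
    using generated_entourages_image[OF F] by (rule bexI)
next
  fix D D' assume "D \<in> generated_entourages entourages (range f) f"
    and "D' \<in> generated_entourages entourages (range f) f"
  then obtain E E' where E: "E \<in> entourages" "map_prod f f ` E \<subseteq> D" "E' \<in> entourages" "map_prod f f ` E' \<subseteq> D'"
      and D: "D \<subseteq> range f \<times> range f" "sym D" "D' \<subseteq> range f \<times> range f" "sym D'"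
    by (auto simp: generated_entourages_def)
  have "map_prod f f ` (E \<inter> E') \<subseteq> D \<inter> D'" using E by blast
  then show "D \<inter> D' \<in> generated_entourages entourages (range f) f"
    using entourage_Int[OF E(1,3)] D by (auto simp: generated_entourages_def sym_Int)
next
  fix D D' assume "D \<in> generated_entourages entourages (range f) f"
    "D \<subseteq> D'" "D' \<subseteq> range f \<times> range f" "sym D'"
  then show "D' \<in> generated_entourages entourages (range f) f"
    unfolding generated_entourages_def by blast
qed

lemma chain_lifting: "chain_lifting UNIV entourages (range f) f"
  unfolding chain_lifting_def
proof (intro conjI ballI)
  fix E :: "('a \<times> 'a) set" assume E: "E \<in> entourages"
  obtain F where F: "F \<in> entourages"
      "\<And>x y. (f x, y) \<in> map_prod f f ` F \<Longrightarrow> \<exists>x'. (x, x') \<in> E \<and> f x' = y"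
    using step_lifting[OF E] by blast
  have "\<exists>c. ent_chain UNIV E c \<and> hd c = x \<and> map f c = d"
    if "ent_chain (range f) (map_prod f f ` F) d" "hd d = f x" for x d
    using that
  proof (induction d arbitrary: x)
    case Nil
    then show ?case by (simp add: ent_chain_def)
  next
    case (Cons a d)
    show ?case
    proof (cases "d = []")
      case True
      then show ?thesis using Cons.prems by (intro exI[of _ "[x]"]) (simp add: ent_chain_def)
    next
      case False
      then have step: "(f x, hd d) \<in> map_prod f f ` F" and d: "ent_chain (range f) (map_prod f f ` F) d"
        using Cons.prems by (auto simp: ent_chain_def successively_Cons)
      obtain x' where x': "(x, x') \<in> E" "f x' = hd d" using F(2)[OF step] by blast
      from Cons.IH[OF d x'(2)[symmetric]]
      obtain c where c: "ent_chain UNIV E c" "hd c = x'" "map f c = d" by blast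
      then have "ent_chain UNIV E (x # c)" "map f (x # c) = a # d"
        using x'(1) Cons.prems(2) by (auto simp: ent_chain_def successively_Cons)
      then show ?thesis by (intro exI[of _ "x # c"]) simp
    qed
  qed
  then show "\<exists>F\<in>entourages. \<forall>x0\<in>UNIV. \<forall>d. ent_chain (range f) (map_prod f f ` F) d \<and> hd d = f x0 \<longrightarrow>
      (\<exists>c. ent_chain UNIV E c \<and> hd c = x0 \<and> map f c = d)"
    using F(1) by (intro bexI[of _ F]) simp_all
qed simp

lemma approx_unique_chain_lifts: "approx_unique_chain_lifts UNIV entourages f"
  unfolding approx_unique_chain_lifts_def
proof
  fix E :: "('a \<times> 'a) set" assume E: "E \<in> entourages"
  obtain F where F: "F \<in> entourages" and uniq: "\<And>n c d.
      (\<And>i. i < n \<Longrightarrow> (c i, c (Suc i)) \<in> F \<and> (d i, d (Suc i)) \<in> F) \<Longrightarrow>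
      c 0 = d 0 \<Longrightarrow> (\<And>i. i \<le> n \<Longrightarrow> f (c i) = f (d i)) \<Longrightarrow> (c n, d n) \<in> E"
    using approx_unique[OF E] by blast
  have "ent_close E c d" if c: "ent_chain UNIV F c" and d: "ent_chain UNIV F d"
      and start: "hd c = hd d" and images: "map f c = map f d" for c d
    unfolding ent_close_def list_all2_conv_all_nth
  proof (intro conjI allI impI)
    show len: "length c = length d" using images by (rule map_eq_imp_length_eq)
    fix k assume k: "k < length c"
    show "(c ! k, d ! k) \<in> E"
    proof (rule uniq)
      show "(c ! i, c ! Suc i) \<in> F \<and> (d ! i, d ! Suc i) \<in> F" if "i < k" for i
        using c d k len that by (auto simp: ent_chain_def successively_conv_nth)
      show "c ! 0 = d ! 0" using start c d by (simp add: ent_chain_def hd_conv_nth)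
      show "f (c ! i) = f (d ! i)" if "i \<le> k" for i
        using arg_cong[OF images, of "\<lambda>l. l ! i"] k len that by simp
    qed
  qed
  then show "\<exists>F\<in>entourages. \<forall>c d. ent_chain UNIV F c \<and> ent_chain UNIV F d \<and> hd c = hd d \<and>
      map f c = map f d \<longrightarrow> ent_close E c d"
    using F by (intro bexI[of _ F]) simp_all
qed

theorem generalized_uniform_covering_complete_fibers:
  assumes "\<And>y. y \<in> range f \<Longrightarrow> complete (f -` {y})"
  shows "generalized_uniform_covering UNIV entourages
    (range f) (generated_entourages entourages (range f) f) f"
  unfolding generalized_uniform_covering_def
  by (intro conjI subset_refl uniform_structure_entourages uniform_structure_generated_entourages
      generates_generated_entourages chain_lifting approx_unique_chain_lifts
      generalized_path_lifting_complete_fibers[OF generates_generated_entourages] assms)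

end

section \<open>Pro-discrete actions\<close>

text \<open>
  The pairs all of whose translates lie in \<open>E\<close> form an invariant set, and equicontinuity says that it
  is an entourage.
\<close>

lemma invariant_entourage:
  assumes act: "group_action G UNIV \<phi>" and equi: "equicontinuous_action G \<phi>"
    and E: "(E :: ('a::uniform_space \<times> 'a) set) \<in> entourages"
  shows "\<exists>F\<in>entourages. F \<subseteq> E \<and> (\<forall>g\<in>carrier G. \<forall>(x, y)\<in>F. (\<phi> g x, \<phi> g y) \<in> F)"
proof -
  interpret group_action G UNIV \<phi> by (rule act)
  interpret group G using group_hom group_hom.axioms(1) by auto
  define F where "F = {(x, y). \<forall>g\<in>carrier G. (\<phi> g x, \<phi> g y) \<in> E}"
  obtain F0 where F0: "F0 \<in> entourages" "\<forall>g\<in>carrier G. \<forall>(x, y)\<in>F0. (\<phi> g x, \<phi> g y) \<in> E"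
    using equi E by (auto simp: equicontinuous_action_def)
  have "F0 \<subseteq> F" using F0(2) by (auto simp: F_def)
  then have "eventually (\<lambda>q. q \<in> F) uniformity"
    using F0(1) by (auto simp: entourages_def elim: eventually_mono)
  moreover have "sym F"
    by (rule symI) (simp add: F_def, blast intro: entourage_sym[OF E])
  ultimately have "F \<in> entourages" by (simp add: entourages_def)
  moreover have "F \<subseteq> E"
  proof
    fix z assume "z \<in> F"
    then have "(\<phi> \<one>\<^bsub>G\<^esub> (fst z), \<phi> \<one>\<^bsub>G\<^esub> (snd z)) \<in> E" by (auto simp: F_def)
    then show "z \<in> E" by (simp flip: id_eq_one)
  qed
  moreover have "(\<phi> g x, \<phi> g y) \<in> F" if "g \<in> carrier G" "(x, y) \<in> F" for g x y
  proof -
    have "(\<phi> h (\<phi> g x), \<phi> h (\<phi> g y)) \<in> E" if h: "h \<in> carrier G" for h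
    proof -
      have "(\<phi> (h \<otimes>\<^bsub>G\<^esub> g) x, \<phi> (h \<otimes>\<^bsub>G\<^esub> g) y) \<in> E"
        using \<open>(x, y) \<in> F\<close> h \<open>g \<in> carrier G\<close> by (simp add: F_def)
      then show ?thesis using h \<open>g \<in> carrier G\<close> by (simp add: composition_rule)
    qed
    then show ?thesis by (simp add: F_def)
  qed
  ultimately show ?thesis by (intro bexI[of _ F]) auto
qed

lemma orbit_eqD:
  assumes act: "group_action G UNIV \<phi>" and eq: "orbit G \<phi> x = orbit G \<phi> y"
  shows "\<exists>g\<in>carrier G. y = \<phi> g x"
proof -
  have "y \<in> orbit G \<phi> x" unfolding eq using group_action.orbit_refl[OF act] by blast
  then show ?thesis by (auto simp: orbit_def)
qed

lemma orbit_image: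
  assumes act: "group_action G UNIV \<phi>" and g: "g \<in> carrier G"
  shows "orbit G \<phi> (\<phi> g x) = orbit G \<phi> x"
proof -
  have to: "\<phi> g x \<in> orbit G \<phi> x" using g by (auto simp: orbit_def)
  then have from_image: "x \<in> orbit G \<phi> (\<phi> g x)"
    by (rule group_action.orbit_sym[OF act UNIV_I UNIV_I])
  show ?thesis
    using group_action.orbit_trans[OF act UNIV_I UNIV_I UNIV_I to]
      group_action.orbit_trans[OF act UNIV_I UNIV_I UNIV_I from_image]
    by (intro equalityI subsetI)
qed

text \<open>
  If \<open>c\<close> and \<open>d\<close> are chains with the same image and \<open>d k = g \<cdot> c k\<close>, then \<open>g \<cdot> c (k + 1)\<close> is close to
  \<open>d k\<close> by invariance, hence to \<open>d (k + 1) = h \<cdot> c (k + 1)\<close>. So the element \<open>h \<cdot> g\<^sup>-\<^sup>1\<close> moves the point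
  \<open>g \<cdot> c (k + 1)\<close> only slightly. By induction the points \<open>c k\<close> and \<open>d k\<close> belong to one orbit of the
  subgroup generated by such elements.
\<close>

lemma pro_discrete_chain_covering:
  fixes \<phi> :: "'g \<Rightarrow> 'a::uniform_space \<Rightarrow> 'a"
  assumes act: "group_action G UNIV \<phi>" and pd: "pro_discrete_action G \<phi>"
  shows "chain_covering (orbit G \<phi>)"
proof
  interpret group_action G UNIV \<phi> by (rule act)
  interpret group G using group_hom group_hom.axioms(1) by auto
  have equi: "equicontinuous_action G \<phi>" and small: "small_scale_bounded_orbits G \<phi>"
    using pd by (auto simp: pro_discrete_action_def)
  fix E :: "('a \<times> 'a) set" assume E: "E \<in> entourages"
  obtain I where I: "I \<in> entourages" "I \<subseteq> E" "\<And>g x y. g \<in> carrier G \<Longrightarrow> (x, y) \<in> I \<Longrightarrow> (\<phi> g x, \<phi> g y) \<in> I"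
    using invariant_entourage[OF act equi E] by blast
  have "\<exists>x'. (x, x') \<in> E \<and> orbit G \<phi> x' = y"
    if "(orbit G \<phi> x, y) \<in> map_prod (orbit G \<phi>) (orbit G \<phi>) ` I" for x y
  proof -
    from that obtain a b where ab: "(a, b) \<in> I" "orbit G \<phi> a = orbit G \<phi> x" "y = orbit G \<phi> b" by auto
    obtain g where g: "g \<in> carrier G" "x = \<phi> g a" using orbit_eqD[OF act ab(2)] by blast
    show ?thesis
      using I(2) I(3)[OF g(1) ab(1)] g orbit_image[OF act g(1), of b] ab(3)
      by (intro exI[of _ "\<phi> g b"]) auto
  qed
  then show "\<exists>F\<in>entourages. \<forall>x y. (orbit G \<phi> x, y) \<in> map_prod (orbit G \<phi>) (orbit G \<phi>) ` F \<longrightarrow>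
      (\<exists>x'. (x, x') \<in> E \<and> orbit G \<phi> x' = y)"
    using I(1) by (intro bexI[of _ I]) simp_all
  obtain F where F: "F \<in> entourages" "\<forall>A\<in>orbits (small_subgroup G \<phi> F) UNIV \<phi>. A \<times> A \<subseteq> E"
    using small E by (auto simp: small_scale_bounded_orbits_def)
  obtain K where K: "K \<in> entourages" "K \<subseteq> F" "\<And>x y z. (x, y) \<in> K \<Longrightarrow> (y, z) \<in> K \<Longrightarrow> (x, z) \<in> F"
    using entourage_halfE[OF F(1)] by metis
  obtain J where J: "J \<in> entourages" "J \<subseteq> K" "\<And>g x y. g \<in> carrier G \<Longrightarrow> (x, y) \<in> J \<Longrightarrow> (\<phi> g x, \<phi> g y) \<in> J"
    using invariant_entourage[OF act equi K(1)] by blast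
  let ?S = "generate G (small_elements G \<phi> F)"
  have S: "g \<in> carrier G" if "g \<in> ?S" for g
    using that by (rule generate_in_carrier[rotated]) (auto simp: small_elements_def)
  have moved: "\<exists>g\<in>?S. d k = \<phi> g (c k)" if "k \<le> n"
      and steps: "\<forall>i<n. (c i, c (Suc i)) \<in> J \<and> (d i, d (Suc i)) \<in> J"
      and start: "c 0 = d 0" and same: "\<forall>i\<le>n. orbit G \<phi> (c i) = orbit G \<phi> (d i)" for n c d k
    using \<open>k \<le> n\<close>
  proof (induction k)
    case 0
    show ?case using start by (intro bexI[of _ "\<one>\<^bsub>G\<^esub>"]) (simp_all add: generate.one flip: id_eq_one)
  next
    case (Suc k)
    then obtain g where g: "g \<in> ?S" "d k = \<phi> g (c k)" by auto
    from orbit_eqD[OF act same[rule_format, OF Suc.prems]]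
    obtain h where h: "h \<in> carrier G" "d (Suc k) = \<phi> h (c (Suc k))" by blast
    have gc: "g \<in> carrier G" by (rule S[OF g(1)])
    define z where "z = \<phi> g (c (Suc k))"
    have "(d k, z) \<in> J" using J(3)[OF gc] steps Suc.prems g(2) by (auto simp: z_def)
    then have "(z, d k) \<in> K" using subsetD[OF J(2)] entourage_sym[OF J(1)] by simp
    moreover have "(d k, d (Suc k)) \<in> K" using steps Suc.prems J(2) by auto
    ultimately have near: "(z, d (Suc k)) \<in> F" by (rule K(3))
    have hg: "(h \<otimes>\<^bsub>G\<^esub> inv\<^bsub>G\<^esub> g) \<otimes>\<^bsub>G\<^esub> g = h" using h(1) gc by (simp add: m_assoc)
    have "d (Suc k) = \<phi> ((h \<otimes>\<^bsub>G\<^esub> inv\<^bsub>G\<^esub> g) \<otimes>\<^bsub>G\<^esub> g) (c (Suc k))" using h(2) by (simp only: hg)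
    also have "\<dots> = \<phi> (h \<otimes>\<^bsub>G\<^esub> inv\<^bsub>G\<^esub> g) z"
      unfolding z_def by (rule composition_rule) (use h(1) gc in auto)
    finally have "h \<otimes>\<^bsub>G\<^esub> inv\<^bsub>G\<^esub> g \<in> small_elements G \<phi> F"
      using near h(1) gc by (auto simp: small_elements_def)
    then have "(h \<otimes>\<^bsub>G\<^esub> inv\<^bsub>G\<^esub> g) \<otimes>\<^bsub>G\<^esub> g \<in> ?S" by (intro generate.eng generate.incl g(1))
    then show ?case using h(2) by (auto simp only: hg)
  qed
  have "(c n, d n) \<in> E"
    if "\<forall>i<n. (c i, c (Suc i)) \<in> J \<and> (d i, d (Suc i)) \<in> J" "c 0 = d 0"
      "\<forall>i\<le>n. orbit G \<phi> (c i) = orbit G \<phi> (d i)" for n c d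
  proof -
    from moved[OF order_refl that] obtain g where g: "g \<in> ?S" "d n = \<phi> g (c n)" by blast
    have orb: "\<phi> h (c n) \<in> orbit (small_subgroup G \<phi> F) \<phi> (c n)" if "h \<in> ?S" for h
      using that by (auto simp: orbit_def small_subgroup_def)
    have "\<phi> \<one>\<^bsub>G\<^esub> (c n) = c n" by (simp flip: id_eq_one)
    then have "c n \<in> orbit (small_subgroup G \<phi> F) \<phi> (c n)" "d n \<in> orbit (small_subgroup G \<phi> F) \<phi> (c n)"
      using orb[OF generate.one] orb[OF g(1)] g(2) by simp_all
    moreover have "orbit (small_subgroup G \<phi> F) \<phi> (c n) \<in> orbits (small_subgroup G \<phi> F) UNIV \<phi>"
      by (auto simp: orbits_def)
    ultimately show ?thesis using F(2) by blast
  qed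
  then show "\<exists>F\<in>entourages. \<forall>n c d. (\<forall>i<n. (c i, c (Suc i)) \<in> F \<and> (d i, d (Suc i)) \<in> F) \<longrightarrow>
      c 0 = d 0 \<longrightarrow> (\<forall>i\<le>n. orbit G \<phi> (c i) = orbit G \<phi> (d i)) \<longrightarrow> (c n, d n) \<in> E"
    using J(1) by (intro bexI[of _ J]) simp_all
qed

theorem corollary3p18:
  fixes G :: "('g, 'm) monoid_scheme"
    and \<phi> :: "'g \<Rightarrow> 'a::uniform_space \<Rightarrow> 'a"
  assumes "group_action G UNIV \<phi>"
    and "pro_discrete_action G \<phi>"
    and "chain_connected (UNIV :: 'a set) entourages"
    and "\<forall>y \<in> orbits G UNIV \<phi>. complete (orbit G \<phi> -` {y})"
  shows "generalized_uniform_covering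
           (UNIV :: 'a set) entourages
           (orbits G UNIV \<phi>) (generated_entourages entourages (orbits G UNIV \<phi>) (orbit G \<phi>))
           (orbit G \<phi>)"
proof -
  interpret chain_covering "orbit G \<phi>"
    using assms(1,2) by (rule pro_discrete_chain_covering)
  have "orbits G UNIV \<phi> = range (orbit G \<phi>)" by (auto simp: orbits_def)
  then show ?thesis
    using generalized_uniform_covering_complete_fibers assms(4) by simp
qed

end
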